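(* Let $\mathbb{A}$ and $\mathbb{X}$ be double categories. A horizontal double adjunction $F\dashv G$ with $F\colon\mathbb{X}\to\mathbb{A}$ and $G\colon\mathbb{A}\to\mathbb{X}$ is completely determined by the items in any one of the following lists (i.e. giving a horizontal double adjunction is equivalent to giving the data of any one list): (i) Double functors $F\colon\mathbb{X}\to\mathbb{A}$, $G\colon\mathbb{A}\to\mathbb{X}$ and a horizontal natural transformation $\eta\colon1_{\mathbb{X}}\Rightarrow GF$ such that for each vertical morphism $j$ in $\mathbb{X}$ the square $\eta_j$ is universal from $j$ to $G$. (ii) A double functor $G\colon\mathbb{A}\to\mathbb{X}$ and functors $F_0\colon(\mathrm{Obj}\,\mathbb{X},\mathrm{Ver}\,\mathbb{X})\to(\mathrm{Obj}\,\mathbb{A},\mathrm{Ver}\,\mathbb{A})$ and $\eta\colon(\mathrm{Obj}\,\mathbb{X},\mathrm{Ver}\,\mathbb{X})\to(\mathrm{Hor}\,\mathbb{X},\mathrm{Sq}\,\mathbb{X})$ such that for each vertical morphism $j\colon X\to Y$ in $\mathbb{X}$ the square $\eta_j$ has left side $j$, right side $GF_0j$, top $\eta_X\colon X\to GF_0X$, bottom $\eta_Y\colon Y\to GF_0Y$, and is universal from $j$ to $G$. Then the double functor $F$ is defined on vertical morphisms by $F_0$ and on squares $\chi$ (with left side $s\chi$ and right side $t\chi$) by universality via $[\eta_{s\chi}\ \ GF\chi]=[\chi\ \ \eta_{t\chi}]$. (iii) Double functors $F\colon\mathbb{X}\to\mathbb{A}$, $G\colon\mathbb{A}\to\mathbb{X}$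 and a horizontal natural transformation $\varepsilon\colon FG\Rightarrow1_{\mathbb{A}}$ such that for each vertical morphism $k$ in $\mathbb{A}$ the square $\varepsilon_k$ is universal from $F$ to $k$. (iv) A double functor $F\colon\mathbb{X}\to\mathbb{A}$ and functors $G_0\colon(\mathrm{Obj}\,\mathbb{A},\mathrm{Ver}\,\mathbb{A})\to(\mathrm{Obj}\,\mathbb{X},\mathrm{Ver}\,\mathbb{X})$ and $\varepsilon\colon(\mathrm{Obj}\,\mathbb{A},\mathrm{Ver}\,\mathbb{A})\to(\mathrm{Hor}\,\mathbb{A},\mathrm{Sq}\,\mathbb{A})$ such that for each vertical morphism $k\colon A\to B$ in $\mathbb{A}$ the square $\varepsilon_k$ has left side $FG_0k$, right side $k$, top $\varepsilon_A\colon FG_0A\to A$, bottom $\varepsilon_B\colon FG_0B\to B$, and is universal from $F$ to $k$. Then the double functor $G$ is defined on vertical morphisms by $G_0$ and on squares $\alpha$ (with left side $s\alpha$ and right side $t\alpha$) by universality via $[FG\alpha\ \ \varepsilon_{t\alpha}]=[\varepsilon_{s\alpha}\ \ \alpha]$. (v) Double functors $F\colon\mathbb{X}\to\mathbb{A}$, $G\colon\mathbb{A}\to\mathbb{X}$ and bijections $\varphi_{j,k}\colon\mathbb{A}(Fj,k)\to\mathbb{X}(j,Gk)$, natural in the vertical morphisms $j$ of $\mathbb{X}$ and $k$ of $\mathbb{A}$, i.e. $\varphi([F\sigma\ \ \alpha])=[\sigma\ \ \varphi(\alpha)]$ and $\varphi([\alpha\ \ \tau])=[\varphi(\alpha)\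 \ G\tau]$ for squares $\sigma\in\mathbb{X}(j',j)$, $\alpha\in\mathbb{A}(Fj,k)$, $\tau\in\mathbb{A}(k,k')$, and compatible with vertical composition, which means $\varphi\left(\begin{bmatrix}\alpha\\ \beta\end{bmatrix}\right)=\begin{bmatrix}\varphi(\alpha)\\ \varphi(\beta)\end{bmatrix}$. (vi) Double functors $F\colon\mathbb{X}\to\mathbb{A}$, $G\colon\mathbb{A}\to\mathbb{X}$ and a horizontal natural isomorphism between the vertically lax double functors (parameterized presheaves) $\mathbb{A}(F-,-)$ and $\mathbb{X}(-,G-)\colon\mathbb{X}^{\mathrm{horop}}\times\mathbb{A}\to\mathbb{S}\mathrm{pan}^t$.
   Context: **Double categories.** Double categories are strict (internal categories in $\mathbf{Cat}$): objects, horizontal morphisms ($\mathrm{Hor}$), vertical morphisms ($\mathrm{Ver}$), squares ($\mathrm{Sq}$). $[\alpha\ \beta]$ denotes horizontal composition ($\alpha$ on the left; $[f\ g]=g\circ f$), $\begin{bmatrix}\alpha\\ \beta\end{bmatrix}$ vertical composition ($\alpha$ on top); $1^v_C$ is the vertical identity, $i^v_f$ the vertical identity square of a horizontal morphism $f$. $\mathbb{D}(j,k)$ is the set of squares with left side $j$ and right side $k$. $(\mathrm{Obj}\,\mathbb{D},\mathrm{Ver}\,\mathbb{D})$ is the category of objects and vertical morphisms; $(\mathrm{Hor}\,\mathbb{D},\mathrm{Sq}\,\mathbb{D})$ is the category of horizontal morphisms and squares under vertical composition. $\mathbb{D}^{\mathrm{horop}}$ reverses the horizontal direction. **Horizontal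 double adjunction.** An adjunction in the 2-category of double categories, double functors and horizontal natural transformations, i.e. double functors $F,G$ with horizontal natural transformations $\eta\colon1_{\mathbb{X}}\Rightarrow GF$, $\varepsilon\colon FG\Rightarrow1_{\mathbb{A}}$ satisfying the two triangle identities. A horizontal natural transformation $\theta\colon F\Rightarrow G$ assigns to each object $A$ a horizontal morphism $\theta_A\colon FA\to GA$ and to each vertical morphism $j\colon A\to C$ a square $\theta_j$ with left $Fj$, right $Gj$, top $\theta_A$, bottom $\theta_C$, such that $\theta_{1^v_A}=i^v_{\theta_A}$, $\theta_{\begin{bmatrix}j_1\\ j_2\end{bmatrix}}=\begin{bmatrix}\theta_{j_1}\\ \theta_{j_2}\end{bmatrix}$, and $[F\alpha\ \theta_k]=[\theta_j\ G\alpha]$ for each square $\alpha$ with left $j$, right $k$. **Universal squares.** For a double functor $S\colon\mathbb{D}\to\mathbb{C}$, a square $\mu\in\mathbb{C}(j,Sk)$ is universal from $j$ to $S$ if for all vertical morphisms $\ell$ of $\mathbb{D}$ the map $\mathbb{D}(k,\ell)\to\mathbb{C}(j,S\ell)$, $\beta'\mapsto[\mu\ S\beta']$ is a bijection. Dually, $\mu\in\mathbb{C}(Sk,j)$ is universal from $S$ to $j$ if $\mathbb{D}(\ell,k)\to\mathbb{C}(S\ell,j)$, $\beta'\mapsto[S\beta'\ \mu]$ is a bijection for all $\ell$. **Parameterized presheaves.** $\mathbb{S}\mathrm{pan}^t$ has sets as objects, functions as horizontal morphisms, spans as (weakly associative, by pullback) vertical morphisms, and morphisms of spans as squares. A vertically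 lax double functor $K\colon\mathbb{E}\to\mathbb{S}\mathrm{pan}^t$ consists of sets $K(C)$ for objects, functions $K(f)$ for horizontal morphisms, spans $K(C)\leftarrow K(j)\to K(C')$ for vertical $j\colon C\to C'$, morphisms of spans $K(\alpha)$ for squares, strictly functorial horizontally, with span maps $K(j)\times_{K(C')}K(k)\to K\left(\begin{bmatrix}j\\ k\end{bmatrix}\right)$ and $K(C)\to K(1^v_C)$, natural with respect to squares and horizontal morphisms, associative and unital. A horizontal natural transformation $K\Rightarrow L$ consists of functions $K(C)\to L(C)$, $K(j)\to L(j)$ forming span morphisms, natural with respect to horizontal morphisms and squares, and commuting with the comparison maps. $\mathbb{A}(F-,-)$ sends $(X,A)$ to the set of horizontal morphisms $FX\to A$ and vertical $(j,k)$ to the span $\mathbb{A}(Fj,k)$ with top and bottom boundary as legs; horizontal morphisms and squares act by horizontal pre- and postcomposition; the comparison maps are vertical composition of squares and $f\mapsto i^v_f$. $\mathbb{X}(-,G-)$ is analogous. *)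

theory Defs
  imports "HOL-Library.FuncSet"
begin

text \<open>
  Structures live on explicit carrier sets. All compositions are written in diagrammatic order and
  are unconstrained on non-composable arguments. The functions that make up functors,
  transformations and families of bijections are required to be extensional (\<open>undefined\<close>
  off their carriers) so that equality of these data in HOL is equality of the mathematical data.
\<close>

section \<open>Categories and functors\<close>

record ('o, 'a) cat =
  cOb :: "'o set"
  cAr :: "'a set"
  cdom :: "'a \<Rightarrow> 'o"
  ccod :: "'a \<Rightarrow> 'o"
  cid :: "'o \<Rightarrow> 'a"
  ccmp :: "'a \<Rightarrow> 'a \<Rightarrow> 'a"

locale category =
  fixes C :: "('o, 'a) cat"
  assumes dom_in: "f \<in> cAr C \<Longrightarrow> cdom C f \<in> cOb C"
    and cod_in: "f \<in> cAr C \<Longrightarrow> ccod C f \<in> cOb C"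
    and id_in: "x \<in> cOb C \<Longrightarrow> cid C x \<in> cAr C"
    and id_dom: "x \<in> cOb C \<Longrightarrow> cdom C (cid C x) = x"
    and id_cod: "x \<in> cOb C \<Longrightarrow> ccod C (cid C x) = x"
    and cmp_in: "\<lbrakk>f \<in> cAr C; g \<in> cAr C; ccod C f = cdom C g\<rbrakk> \<Longrightarrow> ccmp C f g \<in> cAr C"
    and cmp_dom: "\<lbrakk>f \<in> cAr C; g \<in> cAr C; ccod C f = cdom C g\<rbrakk> \<Longrightarrow> cdom C (ccmp C f g) = cdom C f"
    and cmp_cod: "\<lbrakk>f \<in> cAr C; g \<in> cAr C; ccod C f = cdom C g\<rbrakk> \<Longrightarrow> ccod C (ccmp C f g) = ccod C g"
    and id_left: "f \<in> cAr C \<Longrightarrow> ccmp C (cid C (cdom C f)) f = f"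
    and id_right: "f \<in> cAr C \<Longrightarrow> ccmp C f (cid C (ccod C f)) = f"
    and assoc: "\<lbrakk>f \<in> cAr C; g \<in> cAr C; h \<in> cAr C; ccod C f = cdom C g; ccod C g = cdom C h\<rbrakk>
      \<Longrightarrow> ccmp C (ccmp C f g) h = ccmp C f (ccmp C g h)"

record ('o, 'a, 'p, 'b) cfun =
  on_ob :: "'o \<Rightarrow> 'p"
  on_ar :: "'a \<Rightarrow> 'b"

locale cfunctor = C: category C + D: category D
  for C :: "('o, 'a) cat" and D :: "('p, 'b) cat" +
  fixes T :: "('o, 'a, 'p, 'b) cfun"
  assumes ob: "on_ob T \<in> cOb C \<rightarrow>\<^sub>E cOb D"
    and ar: "on_ar T \<in> cAr C \<rightarrow>\<^sub>E cAr D"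
    and pres_dom: "f \<in> cAr C \<Longrightarrow> cdom D (on_ar T f) = on_ob T (cdom C f)"
    and pres_cod: "f \<in> cAr C \<Longrightarrow> ccod D (on_ar T f) = on_ob T (ccod C f)"
    and pres_id: "x \<in> cOb C \<Longrightarrow> on_ar T (cid C x) = cid D (on_ob T x)"
    and pres_cmp: "\<lbrakk>f \<in> cAr C; g \<in> cAr C; ccod C f = cdom C g\<rbrakk>
      \<Longrightarrow> on_ar T (ccmp C f g) = ccmp D (on_ar T f) (on_ar T g)"

section \<open>Double categories\<close>

text \<open>
  \<open>hsq D \<alpha> \<beta>\<close> is $[\alpha\ \beta]$ and \<open>vsq D \<alpha> \<beta>\<close> has \<open>\<alpha>\<close> on top of
  \<open>\<beta>\<close>; \<open>sqhid D j\<close> is the horizontal identity square of a vertical morphism and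
  \<open>sqvid D f\<close> the vertical identity square of a horizontal morphism.
\<close>

record ('o, 'h, 'v, 's) dbl =
  Obj :: "'o set"
  Hor :: "'h set"
  Ver :: "'v set"
  Sq :: "'s set"
  hdom :: "'h \<Rightarrow> 'o"
  hcod :: "'h \<Rightarrow> 'o"
  hid :: "'o \<Rightarrow> 'h"
  hcmp :: "'h \<Rightarrow> 'h \<Rightarrow> 'h"
  vdom :: "'v \<Rightarrow> 'o"
  vcod :: "'v \<Rightarrow> 'o"
  vid :: "'o \<Rightarrow> 'v"
  vcmp :: "'v \<Rightarrow> 'v \<Rightarrow> 'v"
  sleft :: "'s \<Rightarrow> 'v"
  sright :: "'s \<Rightarrow> 'v"
  sqhid :: "'v \<Rightarrow> 's"
  hsq :: "'s \<Rightarrow> 's \<Rightarrow> 's"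
  stop :: "'s \<Rightarrow> 'h"
  sbot :: "'s \<Rightarrow> 'h"
  sqvid :: "'h \<Rightarrow> 's"
  vsq :: "'s \<Rightarrow> 's \<Rightarrow> 's"

definition ObjHor :: "('o, 'h, 'v, 's) dbl \<Rightarrow> ('o, 'h) cat" where
  "ObjHor D = \<lparr>cOb = Obj D, cAr = Hor D, cdom = hdom D, ccod = hcod D, cid = hid D, ccmp = hcmp D\<rparr>"

definition ObjVer :: "('o, 'h, 'v, 's) dbl \<Rightarrow> ('o, 'v) cat" where
  "ObjVer D = \<lparr>cOb = Obj D, cAr = Ver D, cdom = vdom D, ccod = vcod D, cid = vid D, ccmp = vcmp D\<rparr>"

definition VerSq :: "('o, 'h, 'v, 's) dbl \<Rightarrow> ('v, 's) cat" where
  "VerSq D = \<lparr>cOb = Ver D, cAr = Sq D, cdom = sleft D, ccod = sright D, cid = sqhid D, ccmp = hsq D\<rparr>"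

definition HorSq :: "('o, 'h, 'v, 's) dbl \<Rightarrow> ('h, 's) cat" where
  "HorSq D = \<lparr>cOb = Hor D, cAr = Sq D, cdom = stop D, ccod = sbot D, cid = sqvid D, ccmp = vsq D\<rparr>"

locale double_category =
  fixes D :: "('o, 'h, 'v, 's) dbl"
  assumes ObjHor: "category (ObjHor D)"
    and ObjVer: "category (ObjVer D)"
    and VerSq: "category (VerSq D)"
    and HorSq: "category (HorSq D)"
    and corner_tl: "\<alpha> \<in> Sq D \<Longrightarrow> hdom D (stop D \<alpha>) = vdom D (sleft D \<alpha>)"
    and corner_tr: "\<alpha> \<in> Sq D \<Longrightarrow> hcod D (stop D \<alpha>) = vdom D (sright D \<alpha>)"
    and corner_bl: "\<alpha> \<in> Sq D \<Longrightarrow> hdom D (sbot D \<alpha>) = vcod D (sleft D \<alpha>)"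
    and corner_br: "\<alpha> \<in> Sq D \<Longrightarrow> hcod D (sbot D \<alpha>) = vcod D (sright D \<alpha>)"
    and top_hsq: "\<lbrakk>\<alpha> \<in> Sq D; \<beta> \<in> Sq D; sright D \<alpha> = sleft D \<beta>\<rbrakk>
      \<Longrightarrow> stop D (hsq D \<alpha> \<beta>) = hcmp D (stop D \<alpha>) (stop D \<beta>)"
    and bot_hsq: "\<lbrakk>\<alpha> \<in> Sq D; \<beta> \<in> Sq D; sright D \<alpha> = sleft D \<beta>\<rbrakk>
      \<Longrightarrow> sbot D (hsq D \<alpha> \<beta>) = hcmp D (sbot D \<alpha>) (sbot D \<beta>)"
    and left_vsq: "\<lbrakk>\<alpha> \<in> Sq D; \<beta> \<in> Sq D; sbot D \<alpha> = stop D \<beta>\<rbrakk>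
      \<Longrightarrow> sleft D (vsq D \<alpha> \<beta>) = vcmp D (sleft D \<alpha>) (sleft D \<beta>)"
    and right_vsq: "\<lbrakk>\<alpha> \<in> Sq D; \<beta> \<in> Sq D; sbot D \<alpha> = stop D \<beta>\<rbrakk>
      \<Longrightarrow> sright D (vsq D \<alpha> \<beta>) = vcmp D (sright D \<alpha>) (sright D \<beta>)"
    and top_sqhid: "j \<in> Ver D \<Longrightarrow> stop D (sqhid D j) = hid D (vdom D j)"
    and bot_sqhid: "j \<in> Ver D \<Longrightarrow> sbot D (sqhid D j) = hid D (vcod D j)"
    and left_sqvid: "f \<in> Hor D \<Longrightarrow> sleft D (sqvid D f) = vid D (hdom D f)"
    and right_sqvid: "f \<in> Hor D \<Longrightarrow> sright D (sqvid D f) = vid D (hcod D f)"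
    and sqhid_vcmp: "\<lbrakk>j \<in> Ver D; k \<in> Ver D; vcod D j = vdom D k\<rbrakk>
      \<Longrightarrow> sqhid D (vcmp D j k) = vsq D (sqhid D j) (sqhid D k)"
    and sqvid_hcmp: "\<lbrakk>f \<in> Hor D; g \<in> Hor D; hcod D f = hdom D g\<rbrakk>
      \<Longrightarrow> sqvid D (hcmp D f g) = hsq D (sqvid D f) (sqvid D g)"
    and sqhid_vid: "x \<in> Obj D \<Longrightarrow> sqhid D (vid D x) = sqvid D (hid D x)"
    and interchange: "\<lbrakk>\<alpha> \<in> Sq D; \<beta> \<in> Sq D; \<gamma> \<in> Sq D; \<delta> \<in> Sq D;
        sright D \<alpha> = sleft D \<beta>; sright D \<gamma> = sleft D \<delta>; sbot D \<alpha> = stop D \<gamma>; sbot D \<beta> = stop D \<delta>\<rbrakk>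
      \<Longrightarrow> vsq D (hsq D \<alpha> \<beta>) (hsq D \<gamma> \<delta>) = hsq D (vsq D \<alpha> \<gamma>) (vsq D \<beta> \<delta>)"

definition hors :: "('o, 'h, 'v, 's) dbl \<Rightarrow> 'o \<Rightarrow> 'o \<Rightarrow> 'h set" where
  "hors D x y = {f \<in> Hor D. hdom D f = x \<and> hcod D f = y}"

definition sqs :: "('o, 'h, 'v, 's) dbl \<Rightarrow> 'v \<Rightarrow> 'v \<Rightarrow> 's set" where
  "sqs D j k = {\<alpha> \<in> Sq D. sleft D \<alpha> = j \<and> sright D \<alpha> = k}"

definition horop :: "('o, 'h, 'v, 's) dbl \<Rightarrow> ('o, 'h, 'v, 's) dbl" where
  "horop D = D\<lparr>hdom := hcod D, hcod := hdom D, hcmp := (\<lambda>f g. hcmp D g f),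
     sleft := sright D, sright := sleft D, hsq := (\<lambda>\<alpha> \<beta>. hsq D \<beta> \<alpha>)\<rparr>"

definition dbl_prod ::
  "('o, 'h, 'v, 's) dbl \<Rightarrow> ('p, 'k, 'w, 't) dbl \<Rightarrow> ('o \<times> 'p, 'h \<times> 'k, 'v \<times> 'w, 's \<times> 't) dbl" where
  "dbl_prod D E = \<lparr>
     Obj = Obj D \<times> Obj E, Hor = Hor D \<times> Hor E, Ver = Ver D \<times> Ver E, Sq = Sq D \<times> Sq E,
     hdom = map_prod (hdom D) (hdom E), hcod = map_prod (hcod D) (hcod E),
     hid = map_prod (hid D) (hid E),
     hcmp = (\<lambda>(f, f') (g, g'). (hcmp D f g, hcmp E f' g')),
     vdom = map_prod (vdom D) (vdom E), vcod = map_prod (vcod D) (vcod E),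
     vid = map_prod (vid D) (vid E),
     vcmp = (\<lambda>(j, j') (k, k'). (vcmp D j k, vcmp E j' k')),
     sleft = map_prod (sleft D) (sleft E), sright = map_prod (sright D) (sright E),
     sqhid = map_prod (sqhid D) (sqhid E),
     hsq = (\<lambda>(\<alpha>, \<alpha>') (\<beta>, \<beta>'). (hsq D \<alpha> \<beta>, hsq E \<alpha>' \<beta>')),
     stop = map_prod (stop D) (stop E), sbot = map_prod (sbot D) (sbot E),
     sqvid = map_prod (sqvid D) (sqvid E),
     vsq = (\<lambda>(\<alpha>, \<alpha>') (\<beta>, \<beta>'). (vsq D \<alpha> \<beta>, vsq E \<alpha>' \<beta>'))\<rparr>"

section \<open>Double functors\<close>

record ('o, 'h, 'v, 's, 'p, 'k, 'w, 't) dfun =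
  fobj :: "'o \<Rightarrow> 'p"
  fhor :: "'h \<Rightarrow> 'k"
  fver :: "'v \<Rightarrow> 'w"
  fsq :: "'s \<Rightarrow> 't"

definition vertical_part :: "('o, 'h, 'v, 's, 'p, 'k, 'w, 't) dfun \<Rightarrow> ('o, 'v, 'p, 'w) cfun" where
  "vertical_part F = \<lparr>on_ob = fobj F, on_ar = fver F\<rparr>"

locale double_functor = D: double_category D + C: double_category C
  for D :: "('o, 'h, 'v, 's) dbl" and C :: "('p, 'k, 'w, 't) dbl" +
  fixes F :: "('o, 'h, 'v, 's, 'p, 'k, 'w, 't) dfun"
  assumes obj_hor: "cfunctor (ObjHor D) (ObjHor C) \<lparr>on_ob = fobj F, on_ar = fhor F\<rparr>"
    and obj_ver: "cfunctor (ObjVer D) (ObjVer C) (vertical_part F)"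
    and ver_sq: "cfunctor (VerSq D) (VerSq C) \<lparr>on_ob = fver F, on_ar = fsq F\<rparr>"
    and hor_sq: "cfunctor (HorSq D) (HorSq C) \<lparr>on_ob = fhor F, on_ar = fsq F\<rparr>"

definition dfun_id :: "('o, 'h, 'v, 's) dbl \<Rightarrow> ('o, 'h, 'v, 's, 'o, 'h, 'v, 's) dfun" where
  "dfun_id D = \<lparr>fobj = (\<lambda>x\<in>Obj D. x), fhor = (\<lambda>f\<in>Hor D. f), fver = (\<lambda>j\<in>Ver D. j), fsq = (\<lambda>\<alpha>\<in>Sq D. \<alpha>)\<rparr>"

text \<open>\<open>dfun_comp D F G\<close> is $GF$, for $F$ with domain \<open>D\<close>.\<close>

definition dfun_comp ::
  "('o, 'h, 'v, 's) dbl \<Rightarrow> ('o, 'h, 'v, 's, 'p, 'k, 'w, 't) dfun \<Rightarrow>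
   ('p, 'k, 'w, 't, 'q, 'l, 'x, 'u) dfun \<Rightarrow> ('o, 'h, 'v, 's, 'q, 'l, 'x, 'u) dfun" where
  "dfun_comp D F G = \<lparr>fobj = (\<lambda>x\<in>Obj D. fobj G (fobj F x)), fhor = (\<lambda>f\<in>Hor D. fhor G (fhor F f)),
     fver = (\<lambda>j\<in>Ver D. fver G (fver F j)), fsq = (\<lambda>\<alpha>\<in>Sq D. fsq G (fsq F \<alpha>))\<rparr>"

section \<open>Horizontal natural transformations\<close>

text \<open>
  A transformation between double functors from \<open>D\<close> to \<open>C\<close> is represented by its components
  on objects (horizontal morphisms of \<open>C\<close>) and on vertical morphisms (squares of \<open>C\<close>);
  this is the same kind of data as a functor from \<open>ObjVer D\<close> to \<open>HorSq C\<close>.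
\<close>

type_synonym ('o, 'v, 'k, 't) trans = "('o, 'v, 'k, 't) cfun"

locale hor_nat_trans = F: double_functor D C F + G: double_functor D C G
  for D :: "('o, 'h, 'v, 's) dbl" and C :: "('p, 'k, 'w, 't) dbl"
    and F :: "('o, 'h, 'v, 's, 'p, 'k, 'w, 't) dfun" and G :: "('o, 'h, 'v, 's, 'p, 'k, 'w, 't) dfun" +
  fixes \<theta> :: "('o, 'v, 'k, 't) trans"
  assumes ext_ob: "on_ob \<theta> \<in> extensional (Obj D)"
    and ext_ar: "on_ar \<theta> \<in> extensional (Ver D)"
    and at_ob: "x \<in> Obj D \<Longrightarrow> on_ob \<theta> x \<in> hors C (fobj F x) (fobj G x)"
    and at_ver: "j \<in> Ver D \<Longrightarrow> on_ar \<theta> j \<in> sqs C (fver F j) (fver G j)"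
    and at_ver_top: "j \<in> Ver D \<Longrightarrow> stop C (on_ar \<theta> j) = on_ob \<theta> (vdom D j)"
    and at_ver_bot: "j \<in> Ver D \<Longrightarrow> sbot C (on_ar \<theta> j) = on_ob \<theta> (vcod D j)"
    and at_vid: "x \<in> Obj D \<Longrightarrow> on_ar \<theta> (vid D x) = sqvid C (on_ob \<theta> x)"
    and at_vcmp: "\<lbrakk>j \<in> Ver D; k \<in> Ver D; vcod D j = vdom D k\<rbrakk>
      \<Longrightarrow> on_ar \<theta> (vcmp D j k) = vsq C (on_ar \<theta> j) (on_ar \<theta> k)"
    and natural: "\<alpha> \<in> Sq D \<Longrightarrow> hsq C (fsq F \<alpha>) (on_ar \<theta> (sright D \<alpha>)) = hsq C (on_ar \<theta> (sleft D \<alpha>)) (fsq G \<alpha>)"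

definition trans_id ::
  "('o, 'h, 'v, 's) dbl \<Rightarrow> ('p, 'k, 'w, 't) dbl \<Rightarrow> ('o, 'h, 'v, 's, 'p, 'k, 'w, 't) dfun \<Rightarrow>
   ('o, 'v, 'k, 't) trans" where
  "trans_id D C F =
     \<lparr>on_ob = (\<lambda>x\<in>Obj D. hid C (fobj F x)), on_ar = (\<lambda>j\<in>Ver D. sqhid C (fver F j))\<rparr>"

definition trans_comp ::
  "('o, 'h, 'v, 's) dbl \<Rightarrow> ('p, 'k, 'w, 't) dbl \<Rightarrow> ('o, 'v, 'k, 't) trans \<Rightarrow> ('o, 'v, 'k, 't) trans \<Rightarrow>
   ('o, 'v, 'k, 't) trans" where
  "trans_comp D C \<theta> \<kappa> =
     \<lparr>on_ob = (\<lambda>x\<in>Obj D. hcmp C (on_ob \<theta> x) (on_ob \<kappa> x)),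
      on_ar = (\<lambda>j\<in>Ver D. hsq C (on_ar \<theta> j) (on_ar \<kappa> j))\<rparr>"

text \<open>
  The whiskerings: \<open>whisker_after D \<theta> H\<close> has components $H\theta$, and
  \<open>whisker_before D H \<theta>\<close> has components $\theta H$, for $H$ with domain \<open>D\<close>.
\<close>

definition whisker_after ::
  "('o, 'h, 'v, 's) dbl \<Rightarrow> ('o, 'v, 'k, 't) trans \<Rightarrow> ('p, 'k, 'w, 't, 'q, 'l, 'x, 'u) dfun \<Rightarrow>
   ('o, 'v, 'l, 'u) trans" where
  "whisker_after D \<theta> H =
     \<lparr>on_ob = (\<lambda>x\<in>Obj D. fhor H (on_ob \<theta> x)), on_ar = (\<lambda>j\<in>Ver D. fsq H (on_ar \<theta> j))\<rparr>"

definition whisker_before ::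
  "('o, 'h, 'v, 's) dbl \<Rightarrow> ('o, 'h, 'v, 's, 'p, 'k, 'w, 't) dfun \<Rightarrow> ('p, 'w, 'l, 'u) trans \<Rightarrow>
   ('o, 'v, 'l, 'u) trans" where
  "whisker_before D H \<theta> =
     \<lparr>on_ob = (\<lambda>x\<in>Obj D. on_ob \<theta> (fobj H x)), on_ar = (\<lambda>j\<in>Ver D. on_ar \<theta> (fver H j))\<rparr>"

section \<open>Horizontal double adjunctions\<close>

locale hor_double_adjunction =
  unit: hor_nat_trans X X "dfun_id X" "dfun_comp X F G" \<eta> +
  counit: hor_nat_trans A A "dfun_comp A G F" "dfun_id A" \<epsilon> +
  F: double_functor X A F + G: double_functor A X G
  for X :: "('o, 'h, 'v, 's) dbl" and A :: "('p, 'k, 'w, 't) dbl"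
    and F :: "('o, 'h, 'v, 's, 'p, 'k, 'w, 't) dfun" and G :: "('p, 'k, 'w, 't, 'o, 'h, 'v, 's) dfun"
    and \<eta> :: "('o, 'v, 'h, 's) trans" and \<epsilon> :: "('p, 'w, 'k, 't) trans" +
  assumes triangle_F: "trans_comp X A (whisker_after X \<eta> F) (whisker_before X F \<epsilon>) = trans_id X A F"
    and triangle_G: "trans_comp A X (whisker_before A G \<eta>) (whisker_after A \<epsilon> G) = trans_id A X G"

section \<open>Universal squares\<close>

definition universal_from ::
  "('o, 'h, 'v, 's) dbl \<Rightarrow> ('p, 'k, 'w, 't) dbl \<Rightarrow> ('o, 'h, 'v, 's, 'p, 'k, 'w, 't) dfun \<Rightarrow>
   'w \<Rightarrow> 'v \<Rightarrow> 't \<Rightarrow> bool" where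
  "universal_from D C S j k \<mu> \<longleftrightarrow> j \<in> Ver C \<and> k \<in> Ver D \<and> \<mu> \<in> sqs C j (fver S k) \<and>
     (\<forall>l\<in>Ver D. bij_betw (\<lambda>\<beta>. hsq C \<mu> (fsq S \<beta>)) (sqs D k l) (sqs C j (fver S l)))"

definition universal_to ::
  "('o, 'h, 'v, 's) dbl \<Rightarrow> ('p, 'k, 'w, 't) dbl \<Rightarrow> ('o, 'h, 'v, 's, 'p, 'k, 'w, 't) dfun \<Rightarrow>
   'v \<Rightarrow> 'w \<Rightarrow> 't \<Rightarrow> bool" where
  "universal_to D C S k j \<mu> \<longleftrightarrow> k \<in> Ver D \<and> j \<in> Ver C \<and> \<mu> \<in> sqs C (fver S k) j \<and>
     (\<forall>l\<in>Ver D. bij_betw (\<lambda>\<beta>. hsq C (fsq S \<beta>) \<mu>) (sqs D l k) (sqs C (fver S l) j))"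

section \<open>Parameterized presheaves\<close>

text \<open>
  A parameterized presheaf on \<open>E\<close> is a vertically lax double functor from \<open>E\<close> to
  $\mathbb{S}\mathrm{pan}^t$. All its sets \<open>pobj K x\<close> are subsets of one type
  and all the apices \<open>pver K j\<close> subsets of another one; \<open>ptop\<close> and \<open>pbot\<close> are the legs of the
  spans. The comparison map out of the pullback is the curried function \<open>pcmp K j k\<close>, restricted to
  pairs of elements with matching legs. In the coherence axioms the canonical associativity and
  unit isomorphisms of pullbacks are suppressed, as they are invisible on elements.
\<close>

record ('o, 'h, 'v, 's, 'a, 'b) psh =
  pobj :: "'o \<Rightarrow> 'a set"
  phor :: "'h \<Rightarrow> 'a \<Rightarrow> 'a"
  pver :: "'v \<Rightarrow> 'b set"
  ptop :: "'v \<Rightarrow> 'b \<Rightarrow> 'a"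
  pbot :: "'v \<Rightarrow> 'b \<Rightarrow> 'a"
  psq :: "'s \<Rightarrow> 'b \<Rightarrow> 'b"
  pcmp :: "'v \<Rightarrow> 'v \<Rightarrow> 'b \<Rightarrow> 'b \<Rightarrow> 'b"
  punit :: "'o \<Rightarrow> 'a \<Rightarrow> 'b"

locale param_presheaf = E: double_category E
  for E :: "('o, 'h, 'v, 's) dbl" +
  fixes K :: "('o, 'h, 'v, 's, 'a, 'b) psh"
  assumes ptop_in: "j \<in> Ver E \<Longrightarrow> ptop K j \<in> pver K j \<rightarrow> pobj K (vdom E j)"
    and pbot_in: "j \<in> Ver E \<Longrightarrow> pbot K j \<in> pver K j \<rightarrow> pobj K (vcod E j)"
    and phor_in: "f \<in> Hor E \<Longrightarrow> phor K f \<in> pobj K (hdom E f) \<rightarrow> pobj K (hcod E f)"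
    and psq_in: "\<alpha> \<in> Sq E \<Longrightarrow> psq K \<alpha> \<in> pver K (sleft E \<alpha>) \<rightarrow> pver K (sright E \<alpha>)"
    and psq_top: "\<lbrakk>\<alpha> \<in> Sq E; u \<in> pver K (sleft E \<alpha>)\<rbrakk>
      \<Longrightarrow> ptop K (sright E \<alpha>) (psq K \<alpha> u) = phor K (stop E \<alpha>) (ptop K (sleft E \<alpha>) u)"
    and psq_bot: "\<lbrakk>\<alpha> \<in> Sq E; u \<in> pver K (sleft E \<alpha>)\<rbrakk>
      \<Longrightarrow> pbot K (sright E \<alpha>) (psq K \<alpha> u) = phor K (sbot E \<alpha>) (pbot K (sleft E \<alpha>) u)"
    and phor_hid: "\<lbrakk>x \<in> Obj E; a \<in> pobj K x\<rbrakk> \<Longrightarrow> phor K (hid E x) a = a"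
    and phor_hcmp: "\<lbrakk>f \<in> Hor E; g \<in> Hor E; hcod E f = hdom E g; a \<in> pobj K (hdom E f)\<rbrakk>
      \<Longrightarrow> phor K (hcmp E f g) a = phor K g (phor K f a)"
    and psq_sqhid: "\<lbrakk>j \<in> Ver E; u \<in> pver K j\<rbrakk> \<Longrightarrow> psq K (sqhid E j) u = u"
    and psq_hsq: "\<lbrakk>\<alpha> \<in> Sq E; \<beta> \<in> Sq E; sright E \<alpha> = sleft E \<beta>; u \<in> pver K (sleft E \<alpha>)\<rbrakk>
      \<Longrightarrow> psq K (hsq E \<alpha> \<beta>) u = psq K \<beta> (psq K \<alpha> u)"
    and pcmp_span: "\<lbrakk>j \<in> Ver E; k \<in> Ver E; vcod E j = vdom E k; u \<in> pver K j; w \<in> pver K k;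
        pbot K j u = ptop K k w\<rbrakk>
      \<Longrightarrow> pcmp K j k u w \<in> pver K (vcmp E j k) \<and>
          ptop K (vcmp E j k) (pcmp K j k u w) = ptop K j u \<and>
          pbot K (vcmp E j k) (pcmp K j k u w) = pbot K k w"
    and punit_span: "\<lbrakk>x \<in> Obj E; a \<in> pobj K x\<rbrakk>
      \<Longrightarrow> punit K x a \<in> pver K (vid E x) \<and>
          ptop K (vid E x) (punit K x a) = a \<and> pbot K (vid E x) (punit K x a) = a"
    and pcmp_natural: "\<lbrakk>\<alpha> \<in> Sq E; \<beta> \<in> Sq E; sbot E \<alpha> = stop E \<beta>;
        u \<in> pver K (sleft E \<alpha>); w \<in> pver K (sleft E \<beta>); pbot K (sleft E \<alpha>) u = ptop K (sleft E \<beta>) w\<rbrakk>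
      \<Longrightarrow> psq K (vsq E \<alpha> \<beta>) (pcmp K (sleft E \<alpha>) (sleft E \<beta>) u w) =
          pcmp K (sright E \<alpha>) (sright E \<beta>) (psq K \<alpha> u) (psq K \<beta> w)"
    and punit_natural: "\<lbrakk>f \<in> Hor E; a \<in> pobj K (hdom E f)\<rbrakk>
      \<Longrightarrow> psq K (sqvid E f) (punit K (hdom E f) a) = punit K (hcod E f) (phor K f a)"
    and pcmp_assoc: "\<lbrakk>j \<in> Ver E; k \<in> Ver E; l \<in> Ver E; vcod E j = vdom E k; vcod E k = vdom E l;
        u \<in> pver K j; v \<in> pver K k; w \<in> pver K l; pbot K j u = ptop K k v; pbot K k v = ptop K l w\<rbrakk>
      \<Longrightarrow> pcmp K (vcmp E j k) l (pcmp K j k u v) w = pcmp K j (vcmp E k l) u (pcmp K k l v w)"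
    and pcmp_unit_top: "\<lbrakk>j \<in> Ver E; u \<in> pver K j\<rbrakk>
      \<Longrightarrow> pcmp K (vid E (vdom E j)) j (punit K (vdom E j) (ptop K j u)) u = u"
    and pcmp_unit_bot: "\<lbrakk>j \<in> Ver E; u \<in> pver K j\<rbrakk>
      \<Longrightarrow> pcmp K j (vid E (vcod E j)) u (punit K (vcod E j) (pbot K j u)) = u"

record ('o, 'v, 'a, 'b, 'c, 'd) ptrans =
  tobj :: "'o \<Rightarrow> 'a \<Rightarrow> 'c"
  tver :: "'v \<Rightarrow> 'b \<Rightarrow> 'd"

locale psh_trans = K: param_presheaf E K + L: param_presheaf E L
  for E :: "('o, 'h, 'v, 's) dbl"
    and K :: "('o, 'h, 'v, 's, 'a, 'b) psh" and L :: "('o, 'h, 'v, 's, 'c, 'd) psh" +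
  fixes \<theta> :: "('o, 'v, 'a, 'b, 'c, 'd) ptrans"
  assumes tobj_in: "tobj \<theta> \<in> (\<Pi>\<^sub>E x\<in>Obj E. pobj K x \<rightarrow>\<^sub>E pobj L x)"
    and tver_in: "tver \<theta> \<in> (\<Pi>\<^sub>E j\<in>Ver E. pver K j \<rightarrow>\<^sub>E pver L j)"
    and tver_top: "\<lbrakk>j \<in> Ver E; u \<in> pver K j\<rbrakk> \<Longrightarrow> ptop L j (tver \<theta> j u) = tobj \<theta> (vdom E j) (ptop K j u)"
    and tver_bot: "\<lbrakk>j \<in> Ver E; u \<in> pver K j\<rbrakk> \<Longrightarrow> pbot L j (tver \<theta> j u) = tobj \<theta> (vcod E j) (pbot K j u)"
    and natural_hor: "\<lbrakk>f \<in> Hor E; a \<in> pobj K (hdom E f)\<rbrakk>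
      \<Longrightarrow> phor L f (tobj \<theta> (hdom E f) a) = tobj \<theta> (hcod E f) (phor K f a)"
    and natural_sq: "\<lbrakk>\<alpha> \<in> Sq E; u \<in> pver K (sleft E \<alpha>)\<rbrakk>
      \<Longrightarrow> psq L \<alpha> (tver \<theta> (sleft E \<alpha>) u) = tver \<theta> (sright E \<alpha>) (psq K \<alpha> u)"
    and comm_pcmp: "\<lbrakk>j \<in> Ver E; k \<in> Ver E; vcod E j = vdom E k; u \<in> pver K j; w \<in> pver K k;
        pbot K j u = ptop K k w\<rbrakk>
      \<Longrightarrow> tver \<theta> (vcmp E j k) (pcmp K j k u w) = pcmp L j k (tver \<theta> j u) (tver \<theta> k w)"
    and comm_punit: "\<lbrakk>x \<in> Obj E; a \<in> pobj K x\<rbrakk>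
      \<Longrightarrow> tver \<theta> (vid E x) (punit K x a) = punit L x (tobj \<theta> x a)"

definition psh_iso ::
  "('o, 'h, 'v, 's) dbl \<Rightarrow> ('o, 'h, 'v, 's, 'a, 'b) psh \<Rightarrow> ('o, 'h, 'v, 's, 'c, 'd) psh \<Rightarrow>
   ('o, 'v, 'a, 'b, 'c, 'd) ptrans \<Rightarrow> bool" where
  "psh_iso E K L \<theta> \<longleftrightarrow> psh_trans E K L \<theta> \<and>
     (\<exists>\<kappa>. psh_trans E L K \<kappa> \<and>
       (\<forall>x\<in>Obj E. (\<forall>a\<in>pobj K x. tobj \<kappa> x (tobj \<theta> x a) = a) \<and> (\<forall>b\<in>pobj L x. tobj \<theta> x (tobj \<kappa> x b) = b)) \<and>
       (\<forall>j\<in>Ver E. (\<forall>u\<in>pver K j. tver \<kappa> j (tver \<theta> j u) = u) \<and> (\<forall>w\<in>pver L j. tver \<theta> j (tver \<kappa> j w) = w)))"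

text \<open>
  \<open>hom_psh C P Q\<close> is the parameterized presheaf $\mathbb{C}(P-,Q-)$ on
  $\mathbb{X}^{\mathrm{horop}}\times\mathbb{A}$, for double functors $P$ from $\mathbb{X}$ to
  $\mathbb{C}$ and $Q$ from $\mathbb{A}$ to $\mathbb{C}$.
\<close>

definition hom_psh ::
  "('q, 'l, 'x, 'u) dbl \<Rightarrow> ('o, 'h, 'v, 's, 'q, 'l, 'x, 'u) dfun \<Rightarrow> ('p, 'k, 'w, 't, 'q, 'l, 'x, 'u) dfun \<Rightarrow>
   ('o \<times> 'p, 'h \<times> 'k, 'v \<times> 'w, 's \<times> 't, 'l, 'u) psh" where
  "hom_psh C P Q = \<lparr>
     pobj = (\<lambda>(x, a). hors C (fobj P x) (fobj Q a)),
     phor = (\<lambda>(f, g) h. hcmp C (hcmp C (fhor P f) h) (fhor Q g)),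
     pver = (\<lambda>(j, k). sqs C (fver P j) (fver Q k)),
     ptop = (\<lambda>_. stop C),
     pbot = (\<lambda>_. sbot C),
     psq = (\<lambda>(\<sigma>, \<tau>) \<alpha>. hsq C (hsq C (fsq P \<sigma>) \<alpha>) (fsq Q \<tau>)),
     pcmp = (\<lambda>_ _. vsq C),
     punit = (\<lambda>_. sqvid C)\<rparr>"

section \<open>The data determining a horizontal double adjunction\<close>

definition adjunctions where
  "adjunctions X A = {(F, G, \<eta>, \<epsilon>). hor_double_adjunction X A F G \<eta> \<epsilon>}"

definition unit_data where
  "unit_data X A = {(F, G, \<eta>).
     double_functor X A F \<and> double_functor A X G \<and>
     hor_nat_trans X X (dfun_id X) (dfun_comp X F G) \<eta> \<and>
     (\<forall>j\<in>Ver X. universal_from A X G j (fver F j) (on_ar \<eta> j))}"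

definition universal_unit_data where
  "universal_unit_data X A = {(G, F\<^sub>0, \<eta>).
     double_functor A X G \<and> cfunctor (ObjVer X) (ObjVer A) F\<^sub>0 \<and> cfunctor (ObjVer X) (HorSq X) \<eta> \<and>
     (\<forall>j\<in>Ver X.
        on_ar \<eta> j \<in> sqs X j (fver G (on_ar F\<^sub>0 j)) \<and>
        stop X (on_ar \<eta> j) = on_ob \<eta> (vdom X j) \<and>
        on_ob \<eta> (vdom X j) \<in> hors X (vdom X j) (fobj G (on_ob F\<^sub>0 (vdom X j))) \<and>
        sbot X (on_ar \<eta> j) = on_ob \<eta> (vcod X j) \<and>
        on_ob \<eta> (vcod X j) \<in> hors X (vcod X j) (fobj G (on_ob F\<^sub>0 (vcod X j))) \<and>
        universal_from A X G j (on_ar F\<^sub>0 j) (on_ar \<eta> j))}"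

definition counit_data where
  "counit_data X A = {(F, G, \<epsilon>).
     double_functor X A F \<and> double_functor A X G \<and>
     hor_nat_trans A A (dfun_comp A G F) (dfun_id A) \<epsilon> \<and>
     (\<forall>k\<in>Ver A. universal_to X A F (fver G k) k (on_ar \<epsilon> k))}"

definition universal_counit_data where
  "universal_counit_data X A = {(F, G\<^sub>0, \<epsilon>).
     double_functor X A F \<and> cfunctor (ObjVer A) (ObjVer X) G\<^sub>0 \<and> cfunctor (ObjVer A) (HorSq A) \<epsilon> \<and>
     (\<forall>k\<in>Ver A.
        on_ar \<epsilon> k \<in> sqs A (fver F (on_ar G\<^sub>0 k)) k \<and>
        stop A (on_ar \<epsilon> k) = on_ob \<epsilon> (vdom A k) \<and>
        on_ob \<epsilon> (vdom A k) \<in> hors A (fobj F (on_ob G\<^sub>0 (vdom A k))) (vdom A k) \<and>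
        sbot A (on_ar \<epsilon> k) = on_ob \<epsilon> (vcod A k) \<and>
        on_ob \<epsilon> (vcod A k) \<in> hors A (fobj F (on_ob G\<^sub>0 (vcod A k))) (vcod A k) \<and>
        universal_to X A F (on_ar G\<^sub>0 k) k (on_ar \<epsilon> k))}"

text \<open>
  Compatibility with vertical composition is an equation between partially defined composites: it
  includes that the two squares on its right-hand side can be composed. Since $F$ need not be
  injective on objects, composability of $j$ and $j'$ does not follow from that of the squares.
\<close>

definition hom_bijection_data where
  "hom_bijection_data X A = {(F, G, \<phi>).
     double_functor X A F \<and> double_functor A X G \<and>
     \<phi> \<in> (\<Pi>\<^sub>E (j, k)\<in>Ver X \<times> Ver A. sqs A (fver F j) k \<rightarrow>\<^sub>E sqs X j (fver G k)) \<and>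
     (\<forall>j\<in>Ver X. \<forall>k\<in>Ver A. bij_betw (\<phi> (j, k)) (sqs A (fver F j) k) (sqs X j (fver G k))) \<and>
     (\<forall>j'\<in>Ver X. \<forall>j\<in>Ver X. \<forall>k\<in>Ver A. \<forall>\<sigma>\<in>sqs X j' j. \<forall>\<alpha>\<in>sqs A (fver F j) k.
        \<phi> (j', k) (hsq A (fsq F \<sigma>) \<alpha>) = hsq X \<sigma> (\<phi> (j, k) \<alpha>)) \<and>
     (\<forall>j\<in>Ver X. \<forall>k\<in>Ver A. \<forall>k'\<in>Ver A. \<forall>\<alpha>\<in>sqs A (fver F j) k. \<forall>\<tau>\<in>sqs A k k'.
        \<phi> (j, k') (hsq A \<alpha> \<tau>) = hsq X (\<phi> (j, k) \<alpha>) (fsq G \<tau>)) \<and>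
     (\<forall>j\<in>Ver X. \<forall>j'\<in>Ver X. \<forall>k\<in>Ver A. \<forall>k'\<in>Ver A.
        \<forall>\<alpha>\<in>sqs A (fver F j) k. \<forall>\<beta>\<in>sqs A (fver F j') k'.
        vcod X j = vdom X j' \<and> vcod A k = vdom A k' \<and> sbot A \<alpha> = stop A \<beta> \<longrightarrow>
        sbot X (\<phi> (j, k) \<alpha>) = stop X (\<phi> (j', k') \<beta>) \<and>
        \<phi> (vcmp X j j', vcmp A k k') (vsq A \<alpha> \<beta>) = vsq X (\<phi> (j, k) \<alpha>) (\<phi> (j', k') \<beta>))}"

definition presheaf_iso_data where
  "presheaf_iso_data X A = {(F, G, \<theta>).
     double_functor X A F \<and> double_functor A X G \<and>
     psh_iso (dbl_prod (horop X) A) (hom_psh A F (dfun_id A)) (hom_psh X (dfun_id X) G) \<theta>}"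

text \<open>The transposition maps $f \mapsto [\eta_x\ Gf]$ and $\alpha \mapsto [\eta_j\ G\alpha]$.\<close>

definition transpose_hor where
  "transpose_hor X A F G \<eta> =
     (\<lambda>(x, a)\<in>Obj X \<times> Obj A. \<lambda>f\<in>hors A (fobj F x) a. hcmp X (on_ob \<eta> x) (fhor G f))"

definition transpose_sq where
  "transpose_sq X A F G \<eta> =
     (\<lambda>(j, k)\<in>Ver X \<times> Ver A. \<lambda>\<alpha>\<in>sqs A (fver F j) k. hsq X (on_ar \<eta> j) (fsq G \<alpha>))"

end

theory Submission
  imports Defs
begin

text \<open>
  A universal unit consists of squares \<open>\<eta>\<^sub>j\<close>; applied to vertical identity squares, universality
  also yields the ordinary universal property of the horizontal morphisms \<open>\<eta>\<^sub>x\<close>. Since universality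
  gives unique factorizations and vertical composites of factorizations are factorizations, the left
  adjoint and the counit are forced and automatically respect the vertical structure; the triangle
  identities follow as usual. The statements about counits are the same statements for the
  horizontally opposite double categories. A natural family of bijections \<open>\<phi>\<close> is transposition along
  \<open>\<eta>\<^sub>j = \<phi> 1\<^sub>F\<^sub>j\<close>, and an isomorphism of parameterized presheaves is determined by its values on squares.
\<close>

section \<open>Double categories in elementary terms\<close>

text \<open>All six kinds of data are compared with the single set \<open>adjunctions X A\<close>,
  so each round trip must return the given functions exactly, values outside the carriers included.
  Two obstacles shape the argument. Neither \<open>F\<close> nor \<open>G\<close> need be injective
  on objects: squares that can be stacked on one side need not have transposes whose vertical sides
  match, so composability of vertical morphisms is tracked separately from that of squares. And a
  family \<phi> is compatible with vertical composites, with nothing said about vertical identities: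
  at first its value at the identity square of a vertical identity is merely a square that is
  idempotent under vertical composition. Bijectivity and naturality in both variables have to be
  combined to make it a vertical identity square.\<close>

context double_category
begin

text \<open>Rewriting the projections away makes every category law available directly for
  \<open>hcmp\<close>, \<open>vcmp\<close>, \<open>hsq\<close> and \<open>vsq\<close>.\<close>

sublocale hor: category "ObjHor D"
  rewrites "cOb (ObjHor D) = Obj D" and "cAr (ObjHor D) = Hor D"
    and "cdom (ObjHor D) = hdom D" and "ccod (ObjHor D) = hcod D"
    and "cid (ObjHor D) = hid D" and "ccmp (ObjHor D) = hcmp D"
  by (rule ObjHor) (simp_all add: ObjHor_def)

sublocale ver: category "ObjVer D"
  rewrites "cOb (ObjVer D) = Obj D" and "cAr (ObjVer D) = Ver D"
    and "cdom (ObjVer D) = vdom D" and "ccod (ObjVer D) = vcod D"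
    and "cid (ObjVer D) = vid D" and "ccmp (ObjVer D) = vcmp D"
  by (rule ObjVer) (simp_all add: ObjVer_def)

sublocale hsq: category "VerSq D"
  rewrites "cOb (VerSq D) = Ver D" and "cAr (VerSq D) = Sq D"
    and "cdom (VerSq D) = sleft D" and "ccod (VerSq D) = sright D"
    and "cid (VerSq D) = sqhid D" and "ccmp (VerSq D) = hsq D"
  by (rule VerSq) (simp_all add: VerSq_def)

sublocale vsq: category "HorSq D"
  rewrites "cOb (HorSq D) = Hor D" and "cAr (HorSq D) = Sq D"
    and "cdom (HorSq D) = stop D" and "ccod (HorSq D) = sbot D"
    and "cid (HorSq D) = sqvid D" and "ccmp (HorSq D) = vsq D"
  by (rule HorSq) (simp_all add: HorSq_def)

lemmas double_category_simps [simp] =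
  hor.dom_in hor.cod_in hor.id_in hor.id_dom hor.id_cod hor.cmp_in hor.cmp_dom hor.cmp_cod hor.assoc
  ver.dom_in ver.cod_in ver.id_in ver.id_dom ver.id_cod ver.cmp_in ver.cmp_dom ver.cmp_cod ver.assoc
  hsq.dom_in hsq.cod_in hsq.id_in hsq.id_dom hsq.id_cod hsq.cmp_in hsq.cmp_dom hsq.cmp_cod hsq.assoc
  vsq.dom_in vsq.cod_in vsq.id_in vsq.id_dom vsq.id_cod vsq.cmp_in vsq.cmp_dom vsq.cmp_cod vsq.assoc
  corner_tl corner_tr corner_bl corner_br top_hsq bot_hsq left_vsq right_vsq
  top_sqhid bot_sqhid left_sqvid right_sqvid sqhid_vid

lemma hid_hcmp [simp]: "\<lbrakk>f \<in> Hor D; hdom D f = x\<rbrakk> \<Longrightarrow> hcmp D (hid D x) f = f"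
  and hcmp_hid [simp]: "\<lbrakk>f \<in> Hor D; hcod D f = y\<rbrakk> \<Longrightarrow> hcmp D f (hid D y) = f"
  and vid_vcmp [simp]: "\<lbrakk>j \<in> Ver D; vdom D j = x\<rbrakk> \<Longrightarrow> vcmp D (vid D x) j = j"
  and vcmp_vid [simp]: "\<lbrakk>j \<in> Ver D; vcod D j = y\<rbrakk> \<Longrightarrow> vcmp D j (vid D y) = j"
  and sqhid_hsq [simp]: "\<lbrakk>\<alpha> \<in> Sq D; sleft D \<alpha> = j\<rbrakk> \<Longrightarrow> hsq D (sqhid D j) \<alpha> = \<alpha>"
  and hsq_sqhid [simp]: "\<lbrakk>\<alpha> \<in> Sq D; sright D \<alpha> = k\<rbrakk> \<Longrightarrow> hsq D \<alpha> (sqhid D k) = \<alpha>"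
  and sqvid_vsq [simp]: "\<lbrakk>\<alpha> \<in> Sq D; stop D \<alpha> = f\<rbrakk> \<Longrightarrow> vsq D (sqvid D f) \<alpha> = \<alpha>"
  and vsq_sqvid [simp]: "\<lbrakk>\<alpha> \<in> Sq D; sbot D \<alpha> = g\<rbrakk> \<Longrightarrow> vsq D \<alpha> (sqvid D g) = \<alpha>"
  using hor.id_left hor.id_right ver.id_left ver.id_right
    hsq.id_left hsq.id_right vsq.id_left vsq.id_right by auto

lemma sqvid_inject: "\<lbrakk>f \<in> Hor D; g \<in> Hor D; sqvid D f = sqvid D g\<rbrakk> \<Longrightarrow> f = g"
  by (metis vsq.id_dom)

end

lemma (in cfunctor) on_ob_in [simp]: "x \<in> cOb C \<Longrightarrow> on_ob T x \<in> cOb D"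
  and on_ar_in [simp]: "f \<in> cAr C \<Longrightarrow> on_ar T f \<in> cAr D"
  and on_ob_ext: "on_ob T \<in> extensional (cOb C)"
  and on_ar_ext: "on_ar T \<in> extensional (cAr C)"
  using ob ar by (auto simp: PiE_def)

lemma vertical_part_simps [simp]:
  "on_ob (vertical_part F) = fobj F" "on_ar (vertical_part F) = fver F"
  by (simp_all add: vertical_part_def)

context double_functor
begin

sublocale hor: cfunctor "ObjHor D" "ObjHor C" "\<lparr>on_ob = fobj F, on_ar = fhor F\<rparr>"
  rewrites "cOb (ObjHor D) = Obj D" and "cAr (ObjHor D) = Hor D"
    and "cdom (ObjHor D) = hdom D" and "ccod (ObjHor D) = hcod D"
    and "cid (ObjHor D) = hid D" and "ccmp (ObjHor D) = hcmp D"
    and "cOb (ObjHor C) = Obj C" and "cAr (ObjHor C) = Hor C"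
    and "cdom (ObjHor C) = hdom C" and "ccod (ObjHor C) = hcod C"
    and "cid (ObjHor C) = hid C" and "ccmp (ObjHor C) = hcmp C"
    and "on_ob \<lparr>on_ob = fobj F, on_ar = fhor F\<rparr> = fobj F"
    and "on_ar \<lparr>on_ob = fobj F, on_ar = fhor F\<rparr> = fhor F"
  by (rule obj_hor) (simp_all add: ObjHor_def)

sublocale ver: cfunctor "ObjVer D" "ObjVer C" "vertical_part F"
  rewrites "cOb (ObjVer D) = Obj D" and "cAr (ObjVer D) = Ver D"
    and "cdom (ObjVer D) = vdom D" and "ccod (ObjVer D) = vcod D"
    and "cid (ObjVer D) = vid D" and "ccmp (ObjVer D) = vcmp D"
    and "cOb (ObjVer C) = Obj C" and "cAr (ObjVer C) = Ver C"
    and "cdom (ObjVer C) = vdom C" and "ccod (ObjVer C) = vcod C"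
    and "cid (ObjVer C) = vid C" and "ccmp (ObjVer C) = vcmp C"
    and "on_ob (vertical_part F) = fobj F" and "on_ar (vertical_part F) = fver F"
  by (rule obj_ver) (simp_all add: ObjVer_def vertical_part_def)

sublocale hsq: cfunctor "VerSq D" "VerSq C" "\<lparr>on_ob = fver F, on_ar = fsq F\<rparr>"
  rewrites "cOb (VerSq D) = Ver D" and "cAr (VerSq D) = Sq D"
    and "cdom (VerSq D) = sleft D" and "ccod (VerSq D) = sright D"
    and "cid (VerSq D) = sqhid D" and "ccmp (VerSq D) = hsq D"
    and "cOb (VerSq C) = Ver C" and "cAr (VerSq C) = Sq C"
    and "cdom (VerSq C) = sleft C" and "ccod (VerSq C) = sright C"
    and "cid (VerSq C) = sqhid C" and "ccmp (VerSq C) = hsq C"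
    and "on_ob \<lparr>on_ob = fver F, on_ar = fsq F\<rparr> = fver F"
    and "on_ar \<lparr>on_ob = fver F, on_ar = fsq F\<rparr> = fsq F"
  by (rule ver_sq) (simp_all add: VerSq_def)

sublocale vsq: cfunctor "HorSq D" "HorSq C" "\<lparr>on_ob = fhor F, on_ar = fsq F\<rparr>"
  rewrites "cOb (HorSq D) = Hor D" and "cAr (HorSq D) = Sq D"
    and "cdom (HorSq D) = stop D" and "ccod (HorSq D) = sbot D"
    and "cid (HorSq D) = sqvid D" and "ccmp (HorSq D) = vsq D"
    and "cOb (HorSq C) = Hor C" and "cAr (HorSq C) = Sq C"
    and "cdom (HorSq C) = stop C" and "ccod (HorSq C) = sbot C"
    and "cid (HorSq C) = sqvid C" and "ccmp (HorSq C) = vsq C"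
    and "on_ob \<lparr>on_ob = fhor F, on_ar = fsq F\<rparr> = fhor F"
    and "on_ar \<lparr>on_ob = fhor F, on_ar = fsq F\<rparr> = fsq F"
  by (rule hor_sq) (simp_all add: HorSq_def)

lemmas double_functor_simps [simp] =
  hor.pres_dom hor.pres_cod hor.pres_id hor.pres_cmp
  ver.pres_dom ver.pres_cod ver.pres_id ver.pres_cmp
  hsq.pres_dom hsq.pres_cod hsq.pres_id hsq.pres_cmp
  vsq.pres_dom vsq.pres_cod vsq.pres_id vsq.pres_cmp

end

lemma dfun_id_simps [simp]:
  "x \<in> Obj D \<Longrightarrow> fobj (dfun_id D) x = x" "f \<in> Hor D \<Longrightarrow> fhor (dfun_id D) f = f"
  "j \<in> Ver D \<Longrightarrow> fver (dfun_id D) j = j" "\<alpha> \<in> Sq D \<Longrightarrow> fsq (dfun_id D) \<alpha> = \<alpha>"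
  by (simp_all add: dfun_id_def)

lemma dfun_comp_simps [simp]:
  "x \<in> Obj D \<Longrightarrow> fobj (dfun_comp D F G) x = fobj G (fobj F x)"
  "f \<in> Hor D \<Longrightarrow> fhor (dfun_comp D F G) f = fhor G (fhor F f)"
  "j \<in> Ver D \<Longrightarrow> fver (dfun_comp D F G) j = fver G (fver F j)"
  "\<alpha> \<in> Sq D \<Longrightarrow> fsq (dfun_comp D F G) \<alpha> = fsq G (fsq F \<alpha>)"
  by (simp_all add: dfun_comp_def)

text \<open>Objects and vertical morphisms are compared together through
  \<open>vertical_part\<close>, because a universal unit prescribes exactly this part of the left
  adjoint.\<close>

lemma dfun_eqI:
  assumes "double_functor D C F" and "double_functor D C F'"
    and "vertical_part F = vertical_part F'"
    and "\<And>f. f \<in> Hor D \<Longrightarrow> fhor F f = fhor F' f"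
    and "\<And>\<alpha>. \<alpha> \<in> Sq D \<Longrightarrow> fsq F \<alpha> = fsq F' \<alpha>"
  shows "F = F'"
proof -
  interpret F: double_functor D C F by fact
  interpret F': double_functor D C F' by fact
  have "fhor F = fhor F'"
    using F.hor.on_ar_ext F'.hor.on_ar_ext assms(4) by (rule extensionalityI)
  moreover have "fsq F = fsq F'"
    using F.hsq.on_ar_ext F'.hsq.on_ar_ext assms(5) by (rule extensionalityI)
  ultimately show ?thesis using assms(3) by (simp add: vertical_part_def)
qed

lemma double_functor_id:
  assumes "double_category D"
  shows "double_functor D D (dfun_id D)"
proof -
  interpret double_category D by fact
  show ?thesis
    by unfold_locales
      (auto simp: dfun_id_def vertical_part_def ObjHor_def ObjVer_def VerSq_def HorSq_def)
qed

lemma double_functor_comp: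
  assumes "double_functor D C F" and "double_functor C B G"
  shows "double_functor D B (dfun_comp D F G)"
proof -
  interpret F: double_functor D C F by fact
  interpret G: double_functor C B G by fact
  show ?thesis
    by unfold_locales
      (auto simp: dfun_comp_def vertical_part_def ObjHor_def ObjVer_def VerSq_def HorSq_def)
qed


context hor_nat_trans
begin

lemma component_simps [simp]:
  "x \<in> Obj D \<Longrightarrow> on_ob \<theta> x \<in> Hor C"
  "x \<in> Obj D \<Longrightarrow> hdom C (on_ob \<theta> x) = fobj F x"
  "x \<in> Obj D \<Longrightarrow> hcod C (on_ob \<theta> x) = fobj G x"
  "j \<in> Ver D \<Longrightarrow> on_ar \<theta> j \<in> Sq C"
  "j \<in> Ver D \<Longrightarrow> sleft C (on_ar \<theta> j) = fver F j"
  "j \<in> Ver D \<Longrightarrow> sright C (on_ar \<theta> j) = fver G j"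
  "j \<in> Ver D \<Longrightarrow> stop C (on_ar \<theta> j) = on_ob \<theta> (vdom D j)"
  "j \<in> Ver D \<Longrightarrow> sbot C (on_ar \<theta> j) = on_ob \<theta> (vcod D j)"
  "x \<in> Obj D \<Longrightarrow> on_ar \<theta> (vid D x) = sqvid C (on_ob \<theta> x)"
  "\<lbrakk>j \<in> Ver D; k \<in> Ver D; vcod D j = vdom D k\<rbrakk>
    \<Longrightarrow> on_ar \<theta> (vcmp D j k) = vsq C (on_ar \<theta> j) (on_ar \<theta> k)"
  using at_ob at_ver at_ver_top at_ver_bot at_vid at_vcmp by (auto simp: hors_def sqs_def)

text \<open>This is the top boundary of naturality at the vertical identity square of
  \<open>f\<close>.\<close>

lemma natural_hor:
  assumes "f \<in> Hor D"
  shows "hcmp C (fhor F f) (on_ob \<theta> (hcod D f)) = hcmp C (on_ob \<theta> (hdom D f)) (fhor G f)"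
  using arg_cong[OF natural[of "sqvid D f"], of "stop C"] assms by simp

text \<open>Lets a natural transformation serve as the unit of a \<open>universal_unit\<close>,
  where naturality is not part of the data.\<close>

lemma cfunctor: "cfunctor (ObjVer D) (HorSq C) \<theta>"
  by unfold_locales (auto simp: ObjVer_def HorSq_def PiE_def ext_ob ext_ar)

end

lemma trans_eqI:
  assumes "hor_nat_trans D C F G \<theta>" and "hor_nat_trans D C F G \<theta>'"
    and "\<And>x. x \<in> Obj D \<Longrightarrow> on_ob \<theta> x = on_ob \<theta>' x"
    and "\<And>j. j \<in> Ver D \<Longrightarrow> on_ar \<theta> j = on_ar \<theta>' j"
  shows "\<theta> = \<theta>'"
proof -
  interpret \<theta>: hor_nat_trans D C F G \<theta> by fact
  interpret \<theta>': hor_nat_trans D C F G \<theta>' by fact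
  have "on_ob \<theta> = on_ob \<theta>'" "on_ar \<theta> = on_ar \<theta>'"
    using \<theta>.ext_ob \<theta>'.ext_ob \<theta>.ext_ar \<theta>'.ext_ar assms(3,4) by (auto intro: extensionalityI)
  then show ?thesis by simp
qed

section \<open>From a universal unit to an adjunction\<close>

text \<open>The top and bottom of each unit square are encoded in the functoriality of \<eta>, and
  the ends of its components at objects follow from \<open>unit_in\<close> at vertical
  identities.\<close>

locale universal_unit = X: double_category X + G: double_functor A X G
  for X :: "('o, 'h, 'v, 's) dbl" and A :: "('p, 'k, 'w, 't) dbl"
    and G :: "('p, 'k, 'w, 't, 'o, 'h, 'v, 's) dfun" +
  fixes F\<^sub>0 :: "('o, 'v, 'p, 'w) cfun" and \<eta> :: "('o, 'v, 'h, 's) trans"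
  assumes F\<^sub>0: "cfunctor (ObjVer X) (ObjVer A) F\<^sub>0"
    and unit: "cfunctor (ObjVer X) (HorSq X) \<eta>"
    and unit_in: "j \<in> Ver X \<Longrightarrow> on_ar \<eta> j \<in> sqs X j (fver G (on_ar F\<^sub>0 j))"
    and universal: "j \<in> Ver X \<Longrightarrow> universal_from A X G j (on_ar F\<^sub>0 j) (on_ar \<eta> j)"
begin

lemmas F\<^sub>0_simps [simp] =
  cfunctor.on_ob_in [OF F\<^sub>0, unfolded ObjVer_def cat.select_convs]
  cfunctor.on_ar_in [OF F\<^sub>0, unfolded ObjVer_def cat.select_convs]
  cfunctor.pres_dom [OF F\<^sub>0, unfolded ObjVer_def cat.select_convs]
  cfunctor.pres_cod [OF F\<^sub>0, unfolded ObjVer_def cat.select_convs]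
  cfunctor.pres_id [OF F\<^sub>0, unfolded ObjVer_def cat.select_convs]
  cfunctor.pres_cmp [OF F\<^sub>0, unfolded ObjVer_def cat.select_convs]

lemmas unit_simps [simp] =
  cfunctor.on_ob_in [OF unit, unfolded ObjVer_def HorSq_def cat.select_convs]
  cfunctor.on_ar_in [OF unit, unfolded ObjVer_def HorSq_def cat.select_convs]
  cfunctor.pres_dom [OF unit, unfolded ObjVer_def HorSq_def cat.select_convs]
  cfunctor.pres_cod [OF unit, unfolded ObjVer_def HorSq_def cat.select_convs]

lemmas unit_vid [simp] = cfunctor.pres_id [OF unit, unfolded ObjVer_def HorSq_def cat.select_convs]
lemmas unit_vcmp [simp] = cfunctor.pres_cmp [OF unit, unfolded ObjVer_def HorSq_def cat.select_convs]

lemma unit_left [simp]: "j \<in> Ver X \<Longrightarrow> sleft X (on_ar \<eta> j) = j"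
  and unit_right [simp]: "j \<in> Ver X \<Longrightarrow> sright X (on_ar \<eta> j) = fver G (on_ar F\<^sub>0 j)"
  using unit_in by (auto simp: sqs_def)

text \<open>The unit square at a vertical identity is \<open>sqvid X (on_ob \<eta> x)\<close>, so
  the end of its left side reveals the domain of the component.\<close>

lemma unit_ob_dom [simp]: "x \<in> Obj X \<Longrightarrow> hdom X (on_ob \<eta> x) = x"
  using arg_cong[OF unit_left[of "vid X x"], of "vdom X"] by simp

lemma unit_ob_cod [simp]: "x \<in> Obj X \<Longrightarrow> hcod X (on_ob \<eta> x) = fobj G (on_ob F\<^sub>0 x)"
  using arg_cong[OF unit_right[of "vid X x"], of "vdom X"] by simp

section \<open>Transposition along the unit and its inverse\<close>

abbreviation flat :: "'v \<Rightarrow> 't \<Rightarrow> 's" where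
  "flat j \<beta> \<equiv> hsq X (on_ar \<eta> j) (fsq G \<beta>)"

lemma flat_bij:
  "\<lbrakk>j \<in> Ver X; l \<in> Ver A\<rbrakk> \<Longrightarrow> bij_betw (flat j) (sqs A (on_ar F\<^sub>0 j) l) (sqs X j (fver G l))"
  using universal by (simp add: universal_from_def)

text \<open>Equal right sides place both squares in one hom set; universality compares no squares
  with different targets, even if \<open>G\<close> identifies these.\<close>

lemma flat_inject:
  assumes "j \<in> Ver X" and "\<beta> \<in> Sq A" "\<beta>' \<in> Sq A"
    and "sleft A \<beta> = on_ar F\<^sub>0 j" "sleft A \<beta>' = on_ar F\<^sub>0 j" "sright A \<beta> = sright A \<beta>'"
    and "flat j \<beta> = flat j \<beta>'"
  shows "\<beta> = \<beta>'"
proof -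
  have "inj_on (flat j) (sqs A (on_ar F\<^sub>0 j) (sright A \<beta>))"
    using flat_bij assms by (simp add: bij_betw_def)
  then show ?thesis using assms by (auto simp: sqs_def dest: inj_onD)
qed

text \<open>Transposing vertical identity squares gives vertical identity squares of the transposed
  morphisms, so uniqueness for squares applies to them.\<close>

lemma hor_inject:
  assumes "x \<in> Obj X" and "h \<in> Hor A" "h' \<in> Hor A"
    and "hdom A h = on_ob F\<^sub>0 x" "hdom A h' = on_ob F\<^sub>0 x" "hcod A h = hcod A h'"
    and "hcmp X (on_ob \<eta> x) (fhor G h) = hcmp X (on_ob \<eta> x) (fhor G h')"
  shows "h = h'"
proof -
  have "flat (vid X x) (sqvid A h) = sqvid X (hcmp X (on_ob \<eta> x) (fhor G h))" (is "_ = ?r h")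
    if "h \<in> Hor A" "hdom A h = on_ob F\<^sub>0 x" for h using that assms(1) by (simp add: X.sqvid_hcmp)
  then have "sqvid A h = sqvid A h'"
    using assms by (intro flat_inject[of "vid X x"]) auto
  then show ?thesis using assms by (blast dest: G.D.sqvid_inject)
qed

definition sharp :: "'v \<Rightarrow> 'w \<Rightarrow> 's \<Rightarrow> 't" where
  "sharp j l \<tau> = the_inv_into (sqs A (on_ar F\<^sub>0 j) l) (flat j) \<tau>"

text \<open>The factorization of \<open>sqvid X f\<close> is not yet known to be a vertical identity
  square, so its top is selected; \<open>sharp_sqvid\<close> later shows that it is one.\<close>

definition sharp_hor :: "'o \<Rightarrow> 'p \<Rightarrow> 'h \<Rightarrow> 'k" where
  "sharp_hor x a f = stop A (sharp (vid X x) (vid A a) (sqvid X f))"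

lemma sharp_simps [simp]:
  assumes "j \<in> Ver X" "l \<in> Ver A" "\<tau> \<in> Sq X" "sleft X \<tau> = j" "sright X \<tau> = fver G l"
  shows "sharp j l \<tau> \<in> Sq A" "sleft A (sharp j l \<tau>) = on_ar F\<^sub>0 j" "sright A (sharp j l \<tau>) = l"
    and "flat j (sharp j l \<tau>) = \<tau>"
proof -
  have b: "bij_betw (flat j) (sqs A (on_ar F\<^sub>0 j) l) (sqs X j (fver G l))"
    using flat_bij assms by simp
  have \<tau>: "\<tau> \<in> sqs X j (fver G l)" using assms by (simp add: sqs_def)
  have "sharp j l \<tau> \<in> sqs A (on_ar F\<^sub>0 j) l"
    unfolding sharp_def using the_inv_into_into[OF bij_betw_imp_inj_on[OF b]] b \<tau>
    by (auto simp: bij_betw_def)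
  then show "sharp j l \<tau> \<in> Sq A" "sleft A (sharp j l \<tau>) = on_ar F\<^sub>0 j" "sright A (sharp j l \<tau>) = l"
    by (auto simp: sqs_def)
  show "flat j (sharp j l \<tau>) = \<tau>"
    unfolding sharp_def using f_the_inv_into_f_bij_betw[OF b] \<tau> by simp
qed

lemma sharp_hor_simps [simp]:
  assumes "x \<in> Obj X" "a \<in> Obj A" "f \<in> Hor X" "hdom X f = x" "hcod X f = fobj G a"
  shows "sharp_hor x a f \<in> Hor A" "hdom A (sharp_hor x a f) = on_ob F\<^sub>0 x"
    "hcod A (sharp_hor x a f) = a" "hcmp X (on_ob \<eta> x) (fhor G (sharp_hor x a f)) = f"
proof -
  let ?s = "sharp (vid X x) (vid A a) (sqvid X f)"
  show "sharp_hor x a f \<in> Hor A" "hdom A (sharp_hor x a f) = on_ob F\<^sub>0 x"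
    "hcod A (sharp_hor x a f) = a" using assms by (simp_all add: sharp_hor_def)
  have "stop X (flat (vid X x) ?s) = f" using assms by (simp del: unit_vid)
  moreover have "stop X (flat (vid X x) ?s) = hcmp X (on_ob \<eta> x) (fhor G (sharp_hor x a f))"
    using assms unfolding sharp_hor_def by (subst X.top_hsq) auto
  ultimately show "hcmp X (on_ob \<eta> x) (fhor G (sharp_hor x a f)) = f" by metis
qed

lemma sharp_eqI:
  assumes "j \<in> Ver X" "\<beta> \<in> Sq A" "sleft A \<beta> = on_ar F\<^sub>0 j" "sright A \<beta> = l" "flat j \<beta> = \<tau>"
  shows "sharp j l \<tau> = \<beta>"
proof -
  have "\<tau> \<in> Sq X" "sleft X \<tau> = j" "sright X \<tau> = fver G l" using assms by auto
  with assms show ?thesis by (intro flat_inject[of j]) auto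
qed

lemma sharp_hor_eqI:
  assumes "x \<in> Obj X" "h \<in> Hor A" "hdom A h = on_ob F\<^sub>0 x" "hcod A h = a"
    and "hcmp X (on_ob \<eta> x) (fhor G h) = f"
  shows "sharp_hor x a f = h"
proof -
  have "f \<in> Hor X" "hdom X f = x" "hcod X f = fobj G a" using assms by auto
  with assms show ?thesis by (intro hor_inject[of x]) auto
qed

text \<open>Taking tops commutes with transposition, so the top of a factorization factors the top,
  and such a factor is unique. In particular it depends only on the top of \<tau>, which is what
  makes factorizations of stacked squares composable.\<close>

lemma sharp_top [simp]:
  assumes "j \<in> Ver X" "l \<in> Ver A" "\<tau> \<in> Sq X" "sleft X \<tau> = j" "sright X \<tau> = fver G l"
  shows "stop A (sharp j l \<tau>) = sharp_hor (vdom X j) (vdom A l) (stop X \<tau>)"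
proof (rule sharp_hor_eqI [symmetric])
  have "hcmp X (on_ob \<eta> (vdom X j)) (fhor G (stop A (sharp j l \<tau>))) = stop X (flat j (sharp j l \<tau>))"
    using assms by (subst X.top_hsq) auto
  then show "hcmp X (on_ob \<eta> (vdom X j)) (fhor G (stop A (sharp j l \<tau>))) = stop X \<tau>"
    using assms by simp
qed (use assms in auto)

lemma sharp_bot [simp]:
  assumes "j \<in> Ver X" "l \<in> Ver A" "\<tau> \<in> Sq X" "sleft X \<tau> = j" "sright X \<tau> = fver G l"
  shows "sbot A (sharp j l \<tau>) = sharp_hor (vcod X j) (vcod A l) (sbot X \<tau>)"
proof (rule sharp_hor_eqI [symmetric])
  have "hcmp X (on_ob \<eta> (vcod X j)) (fhor G (sbot A (sharp j l \<tau>))) = sbot X (flat j (sharp j l \<tau>))"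
    using assms by (subst X.bot_hsq) auto
  then show "hcmp X (on_ob \<eta> (vcod X j)) (fhor G (sbot A (sharp j l \<tau>))) = sbot X \<tau>"
    using assms by simp
qed (use assms in auto)

lemma sharp_sqvid:
  assumes "x \<in> Obj X" "a \<in> Obj A" "f \<in> Hor X" "hdom X f = x" "hcod X f = fobj G a"
  shows "sharp (vid X x) (vid A a) (sqvid X f) = sqvid A (sharp_hor x a f)"
proof (rule sharp_eqI)
  show "flat (vid X x) (sqvid A (sharp_hor x a f)) = sqvid X f"
    using assms by (simp flip: X.sqvid_hcmp)
qed (use assms in auto)

lemma flat_vsq:
  assumes "j \<in> Ver X" "j' \<in> Ver X" "vcod X j = vdom X j'" "\<beta> \<in> Sq A" "\<beta>' \<in> Sq A"
    and "sleft A \<beta> = on_ar F\<^sub>0 j" "sleft A \<beta>' = on_ar F\<^sub>0 j'" "sbot A \<beta> = stop A \<beta>'"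
  shows "flat (vcmp X j j') (vsq A \<beta> \<beta>') = vsq X (flat j \<beta>) (flat j' \<beta>')"
  using assms by (simp add: X.interchange)

text \<open>The common boundary of \<tau> and \<open>\<tau>'\<close> has one transpose, so the two
  factorizations can be stacked; by interchange the stack factors the composite. Composability of
  \<open>l\<close> and \<open>l'\<close> is a hypothesis, since the squares only show that their
  images under \<open>G\<close> are composable.\<close>

lemma sharp_vsq:
  assumes "\<tau> \<in> Sq X" "\<tau>' \<in> Sq X" "sbot X \<tau> = stop X \<tau>'" "l \<in> Ver A" "l' \<in> Ver A"
    and "vcod A l = vdom A l'" "sright X \<tau> = fver G l" "sright X \<tau>' = fver G l'"
    and "sleft X \<tau> = j" "sleft X \<tau>' = j'"
  shows "sharp (vcmp X j j') (vcmp A l l') (vsq X \<tau> \<tau>') = vsq A (sharp j l \<tau>) (sharp j' l' \<tau>')"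
proof -
  have j: "j \<in> Ver X" "j' \<in> Ver X" using assms by auto
  moreover have e: "vcod X j = vdom X j'" using assms X.corner_bl[of \<tau>] X.corner_tl[of \<tau>'] by metis
  moreover have "sbot A (sharp j l \<tau>) = stop A (sharp j' l' \<tau>')"
    using assms j e by simp
  ultimately show ?thesis using assms
    by (intro sharp_eqI) (auto simp: flat_vsq simp del: sharp_top sharp_bot G.vsq.pres_cmp unit_vcmp)
qed

section \<open>The left adjoint double functor\<close>

definition left_adjoint :: "('o, 'h, 'v, 's, 'p, 'k, 'w, 't) dfun" where
  "left_adjoint = \<lparr>fobj = on_ob F\<^sub>0,
     fhor = (\<lambda>f\<in>Hor X. sharp_hor (hdom X f) (on_ob F\<^sub>0 (hcod X f)) (hcmp X f (on_ob \<eta> (hcod X f)))),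
     fver = on_ar F\<^sub>0,
     fsq = (\<lambda>\<chi>\<in>Sq X. sharp (sleft X \<chi>) (on_ar F\<^sub>0 (sright X \<chi>)) (hsq X \<chi> (on_ar \<eta> (sright X \<chi>))))\<rparr>"

abbreviation (input) "L \<equiv> left_adjoint"

lemma left_adjoint_proj [simp]: "fobj L = on_ob F\<^sub>0" "fver L = on_ar F\<^sub>0"
  by (simp_all add: left_adjoint_def)

lemma vertical_part_left_adjoint [simp]: "vertical_part L = F\<^sub>0"
  by (simp add: vertical_part_def)

lemma fhor_left_adjoint [simp]:
  assumes "f \<in> Hor X"
  shows "fhor L f \<in> Hor A" "hdom A (fhor L f) = on_ob F\<^sub>0 (hdom X f)"
    "hcod A (fhor L f) = on_ob F\<^sub>0 (hcod X f)"
    "hcmp X (on_ob \<eta> (hdom X f)) (fhor G (fhor L f)) = hcmp X f (on_ob \<eta> (hcod X f))"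
  using assms by (simp_all add: left_adjoint_def)

lemma fsq_left_adjoint [simp]:
  assumes "\<chi> \<in> Sq X"
  shows "fsq L \<chi> \<in> Sq A" "sleft A (fsq L \<chi>) = on_ar F\<^sub>0 (sleft X \<chi>)"
    "sright A (fsq L \<chi>) = on_ar F\<^sub>0 (sright X \<chi>)"
    "stop A (fsq L \<chi>) = fhor L (stop X \<chi>)" "sbot A (fsq L \<chi>) = fhor L (sbot X \<chi>)"
    "flat (sleft X \<chi>) (fsq L \<chi>) = hsq X \<chi> (on_ar \<eta> (sright X \<chi>))"
  using assms by (simp_all add: left_adjoint_def)

lemma fhor_left_adjoint_eqI:
  assumes "f \<in> Hor X" "h \<in> Hor A" "hdom A h = on_ob F\<^sub>0 (hdom X f)" "hcod A h = on_ob F\<^sub>0 (hcod X f)"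
    and "hcmp X (on_ob \<eta> (hdom X f)) (fhor G h) = hcmp X f (on_ob \<eta> (hcod X f))"
  shows "fhor L f = h"
  using assms by (intro hor_inject[of "hdom X f"]) auto

lemma fsq_left_adjoint_eqI:
  assumes "\<chi> \<in> Sq X" "\<beta> \<in> Sq A" "sleft A \<beta> = on_ar F\<^sub>0 (sleft X \<chi>)"
    and "sright A \<beta> = on_ar F\<^sub>0 (sright X \<chi>)"
    and "flat (sleft X \<chi>) \<beta> = hsq X \<chi> (on_ar \<eta> (sright X \<chi>))"
  shows "fsq L \<chi> = \<beta>"
  using assms by (intro flat_inject[of "sleft X \<chi>"]) auto

text \<open>Each preservation law holds because both sides solve the defining equation of
  \<open>L\<close>: horizontally by pasting two such equations, vertically by interchange.\<close>

lemma double_functor_left_adjoint: "double_functor X A L"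
proof (intro double_functor.intro double_functor_axioms.intro)
  show "double_category X" "double_category A" ..
  show "cfunctor (ObjVer X) (ObjVer A) (vertical_part L)" by (simp add: F\<^sub>0)
  have hid: "fhor L (hid X x) = hid A (on_ob F\<^sub>0 x)" if "x \<in> Obj X" for x
    using that by (intro fhor_left_adjoint_eqI) auto
  have hcmp: "fhor L (hcmp X f g) = hcmp A (fhor L f) (fhor L g)"
    if "f \<in> Hor X" "g \<in> Hor X" "hcod X f = hdom X g" for f g
  proof (rule fhor_left_adjoint_eqI)
    have "hcmp X (on_ob \<eta> (hdom X f)) (hcmp X (fhor G (fhor L f)) (fhor G (fhor L g)))
        = hcmp X (hcmp X (on_ob \<eta> (hdom X f)) (fhor G (fhor L f))) (fhor G (fhor L g))"
      using that by (subst X.hor.assoc) auto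
    also have "\<dots> = hcmp X (hcmp X f (on_ob \<eta> (hdom X g))) (fhor G (fhor L g))"
      using that by simp
    also have "\<dots> = hcmp X (hcmp X f g) (on_ob \<eta> (hcod X g))"
      using that by simp
    finally show "hcmp X (on_ob \<eta> (hdom X (hcmp X f g))) (fhor G (hcmp A (fhor L f) (fhor L g)))
        = hcmp X (hcmp X f g) (on_ob \<eta> (hcod X (hcmp X f g)))" using that by simp
  qed (use that in auto)
  show "cfunctor (ObjHor X) (ObjHor A) \<lparr>on_ob = fobj L, on_ar = fhor L\<rparr>"
    by unfold_locales
      (use cfunctor.on_ob_ext[OF F\<^sub>0] hid hcmp in
        \<open>auto simp: ObjHor_def ObjVer_def PiE_def left_adjoint_def[THEN arg_cong[of _ _ fhor]]\<close>)
  have sqhid: "fsq L (sqhid X j) = sqhid A (on_ar F\<^sub>0 j)" if "j \<in> Ver X" for j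
    using that by (intro fsq_left_adjoint_eqI) auto
  have hsq: "fsq L (hsq X \<chi> \<psi>) = hsq A (fsq L \<chi>) (fsq L \<psi>)"
    if "\<chi> \<in> Sq X" "\<psi> \<in> Sq X" "sright X \<chi> = sleft X \<psi>" for \<chi> \<psi>
  proof (rule fsq_left_adjoint_eqI)
    have "hsq X (on_ar \<eta> (sleft X \<chi>)) (hsq X (fsq G (fsq L \<chi>)) (fsq G (fsq L \<psi>)))
        = hsq X (hsq X (on_ar \<eta> (sleft X \<chi>)) (fsq G (fsq L \<chi>))) (fsq G (fsq L \<psi>))"
      using that by (subst X.hsq.assoc) auto
    also have "\<dots> = hsq X (hsq X \<chi> (on_ar \<eta> (sleft X \<psi>))) (fsq G (fsq L \<psi>))"
      using that by simp
    also have "\<dots> = hsq X (hsq X \<chi> \<psi>) (on_ar \<eta> (sright X \<psi>))"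
      using that by simp
    finally show "flat (sleft X (hsq X \<chi> \<psi>)) (hsq A (fsq L \<chi>) (fsq L \<psi>))
        = hsq X (hsq X \<chi> \<psi>) (on_ar \<eta> (sright X (hsq X \<chi> \<psi>)))" using that by simp
  qed (use that in auto)
  show "cfunctor (VerSq X) (VerSq A) \<lparr>on_ob = fver L, on_ar = fsq L\<rparr>"
    by unfold_locales
      (use cfunctor.on_ar_ext[OF F\<^sub>0] sqhid hsq in
        \<open>auto simp: VerSq_def ObjVer_def PiE_def left_adjoint_def[THEN arg_cong[of _ _ fsq]]\<close>)
  have sqvid: "fsq L (sqvid X f) = sqvid A (fhor L f)" if "f \<in> Hor X" for f
    using that by (intro fsq_left_adjoint_eqI) (auto simp flip: X.sqvid_hcmp)
  have vsq: "fsq L (vsq X \<chi> \<psi>) = vsq A (fsq L \<chi>) (fsq L \<psi>)"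
    if "\<chi> \<in> Sq X" "\<psi> \<in> Sq X" "sbot X \<chi> = stop X \<psi>" for \<chi> \<psi>
  proof (rule fsq_left_adjoint_eqI)
    \<comment> \<open>\<open>F\<^sub>0\<close> and \<eta> preserve composites of composable vertical
      morphisms only, so the sides of the two squares are matched through their shared
      corners.\<close>
    have [simp]: "vcod X (sleft X \<chi>) = vdom X (sleft X \<psi>)" "vcod X (sright X \<chi>) = vdom X (sright X \<psi>)"
      using that X.corner_bl[of \<chi>] X.corner_tl[of \<psi>] X.corner_br[of \<chi>] X.corner_tr[of \<psi>] by auto
    show "flat (sleft X (vsq X \<chi> \<psi>)) (vsq A (fsq L \<chi>) (fsq L \<psi>))
        = hsq X (vsq X \<chi> \<psi>) (on_ar \<eta> (sright X (vsq X \<chi> \<psi>)))"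
      using that by (simp add: flat_vsq X.interchange del: G.vsq.pres_cmp unit_vcmp)
        (simp add: X.interchange)
    show "sleft A (vsq A (fsq L \<chi>) (fsq L \<psi>)) = on_ar F\<^sub>0 (sleft X (vsq X \<chi> \<psi>))"
      "sright A (vsq A (fsq L \<chi>) (fsq L \<psi>)) = on_ar F\<^sub>0 (sright X (vsq X \<chi> \<psi>))"
      using that by simp_all
  qed (use that in auto)
  show "cfunctor (HorSq X) (HorSq A) \<lparr>on_ob = fhor L, on_ar = fsq L\<rparr>"
    by unfold_locales
      (use sqvid vsq in
        \<open>auto simp: HorSq_def PiE_def left_adjoint_def[THEN arg_cong[of _ _ fsq]]
          left_adjoint_def[THEN arg_cong[of _ _ fhor]]\<close>)
qed

text \<open>Naturality is stated with a further factor \<open>g\<close> because composites are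
  normalized to the right, where the pair formed by the unit and \<open>G L f\<close> is no longer a
  subterm.\<close>

lemma unit_natural_hor:
  assumes "f \<in> Hor X" "hdom X f = x" "g \<in> Hor X" "hdom X g = fobj G (on_ob F\<^sub>0 (hcod X f))"
  shows "hcmp X (on_ob \<eta> x) (hcmp X (fhor G (fhor L f)) g) = hcmp X f (hcmp X (on_ob \<eta> (hcod X f)) g)"
proof -
  have "hcmp X (on_ob \<eta> (hdom X f)) (hcmp X (fhor G (fhor L f)) g)
      = hcmp X (hcmp X (on_ob \<eta> (hdom X f)) (fhor G (fhor L f))) g"
    using assms(1,3,4) by (simp del: fhor_left_adjoint(4))
  also have "\<dots> = hcmp X (hcmp X f (on_ob \<eta> (hcod X f))) g"
    using assms(1) by (simp del: X.hor.assoc)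
  finally show ?thesis using assms by simp
qed

lemma unit_natural_sq:
  assumes "\<chi> \<in> Sq X" "sleft X \<chi> = j" "\<gamma> \<in> Sq X" "sleft X \<gamma> = fver G (on_ar F\<^sub>0 (sright X \<chi>))"
  shows "hsq X (on_ar \<eta> j) (hsq X (fsq G (fsq L \<chi>)) \<gamma>) = hsq X \<chi> (hsq X (on_ar \<eta> (sright X \<chi>)) \<gamma>)"
proof -
  have "hsq X (on_ar \<eta> (sleft X \<chi>)) (hsq X (fsq G (fsq L \<chi>)) \<gamma>) = hsq X (flat (sleft X \<chi>) (fsq L \<chi>)) \<gamma>"
    using assms(1,3,4) by (simp del: fsq_left_adjoint(6))
  also have "\<dots> = hsq X (hsq X \<chi> (on_ar \<eta> (sright X \<chi>))) \<gamma>"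
    using assms(1) by (simp del: X.hsq.assoc)
  finally show ?thesis using assms by simp
qed

section \<open>The counit and the triangle identities\<close>

definition counit :: "('p, 'w, 'k, 't) trans" where
  "counit = \<lparr>on_ob = (\<lambda>a\<in>Obj A. sharp_hor (fobj G a) a (hid X (fobj G a))),
     on_ar = (\<lambda>k\<in>Ver A. sharp (fver G k) k (sqhid X (fver G k)))\<rparr>"

text \<open>The counit is the transpose of an identity, so the last clause is already the triangle
  identity at \<open>G\<close>.\<close>

lemma counit_ob [simp]:
  assumes "a \<in> Obj A"
  shows "on_ob counit a \<in> Hor A" "hdom A (on_ob counit a) = on_ob F\<^sub>0 (fobj G a)"
    "hcod A (on_ob counit a) = a"
    "hcmp X (on_ob \<eta> (fobj G a)) (fhor G (on_ob counit a)) = hid X (fobj G a)"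
  using assms by (simp_all add: counit_def)

lemma counit_ar [simp]:
  assumes "k \<in> Ver A"
  shows "on_ar counit k \<in> Sq A" "sleft A (on_ar counit k) = on_ar F\<^sub>0 (fver G k)"
    "sright A (on_ar counit k) = k" "stop A (on_ar counit k) = on_ob counit (vdom A k)"
    "sbot A (on_ar counit k) = on_ob counit (vcod A k)"
    "flat (fver G k) (on_ar counit k) = sqhid X (fver G k)"
  using assms by (simp_all add: counit_def)

text \<open>After precomposition with the unit, naturality exposes the triangle identity that holds
  by construction and leaves the unit alone; uniqueness of factorizations cancels it.\<close>

lemma triangle_hor:
  assumes "x \<in> Obj X"
  shows "hcmp A (fhor L (on_ob \<eta> x)) (on_ob counit (on_ob F\<^sub>0 x)) = hid A (on_ob F\<^sub>0 x)"
proof -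
  interpret L: double_functor X A L by (rule double_functor_left_adjoint)
  show ?thesis using assms by (intro hor_inject[of x]) (auto simp: unit_natural_hor)
qed

lemma triangle_sq:
  assumes "j \<in> Ver X"
  shows "hsq A (fsq L (on_ar \<eta> j)) (on_ar counit (on_ar F\<^sub>0 j)) = sqhid A (on_ar F\<^sub>0 j)"
proof -
  interpret L: double_functor X A L by (rule double_functor_left_adjoint)
  show ?thesis using assms by (intro flat_inject[of j]) (auto simp: unit_natural_sq)
qed

text \<open>Both sides have the transpose \<open>fsq G \<alpha>\<close>.\<close>

lemma counit_natural:
  assumes "\<alpha> \<in> Sq A"
  shows "hsq A (fsq L (fsq G \<alpha>)) (on_ar counit (sright A \<alpha>)) = hsq A (on_ar counit (sleft A \<alpha>)) \<alpha>"
proof (rule flat_inject[of "fver G (sleft A \<alpha>)"])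
  interpret L: double_functor X A L by (rule double_functor_left_adjoint)
  have "flat (fver G (sleft A \<alpha>)) (hsq A (on_ar counit (sleft A \<alpha>)) \<alpha>)
      = hsq X (flat (fver G (sleft A \<alpha>)) (on_ar counit (sleft A \<alpha>))) (fsq G \<alpha>)"
    using assms by (simp del: counit_ar(6))
  then show "flat (fver G (sleft A \<alpha>)) (hsq A (fsq L (fsq G \<alpha>)) (on_ar counit (sright A \<alpha>)))
      = flat (fver G (sleft A \<alpha>)) (hsq A (on_ar counit (sleft A \<alpha>)) \<alpha>)"
    using assms by (simp add: unit_natural_sq)
qed (use assms in auto)

lemma adjunction: "hor_double_adjunction X A L G \<eta> counit"
proof -
  interpret L: double_functor X A L by (rule double_functor_left_adjoint)
  interpret I: double_functor X X "dfun_id X" by (rule double_functor_id) unfold_locales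
  interpret I': double_functor A A "dfun_id A" by (rule double_functor_id) unfold_locales
  interpret GL: double_functor X X "dfun_comp X L G" by (rule double_functor_comp) unfold_locales
  interpret LG: double_functor A A "dfun_comp A G L" by (rule double_functor_comp) unfold_locales
  interpret unit: hor_nat_trans X X "dfun_id X" "dfun_comp X L G" \<eta>
    by unfold_locales
      (use cfunctor.on_ob_ext[OF unit] cfunctor.on_ar_ext[OF unit] in
        \<open>auto simp: ObjVer_def HorSq_def hors_def sqs_def\<close>)
  interpret counit: hor_nat_trans A A "dfun_comp A G L" "dfun_id A" counit
  proof
    \<comment> \<open>The square being factored is the horizontal identity of a vertical identity,
      hence also a vertical identity square, and \<open>sharp_sqvid\<close> applies.\<close>
    show "on_ar counit (vid A a) = sqvid A (on_ob counit a)" if "a \<in> Obj A" for a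
      using that by (simp add: counit_def sharp_sqvid)
    show "on_ar counit (vcmp A k l) = vsq A (on_ar counit k) (on_ar counit l)"
      if "k \<in> Ver A" "l \<in> Ver A" "vcod A k = vdom A l" for k l
      using that by (simp add: counit_def X.sqhid_vcmp sharp_vsq)
    show "on_ob counit \<in> extensional (Obj A)" "on_ar counit \<in> extensional (Ver A)"
      by (simp_all add: counit_def)
  qed (auto simp: hors_def sqs_def counit_natural)
  show ?thesis
  proof unfold_locales
    show "trans_comp X A (whisker_after X \<eta> L) (whisker_before X L counit) = trans_id X A L"
      by (auto simp: trans_comp_def whisker_after_def whisker_before_def trans_id_def
          triangle_hor triangle_sq intro!: restrict_ext)
    show "trans_comp A X (whisker_before A G \<eta>) (whisker_after A counit G) = trans_id A X G"
      by (auto simp: trans_comp_def whisker_after_def whisker_before_def trans_id_def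
          intro!: restrict_ext)
  qed
qed

text \<open>Naturality of \<eta> into \<open>G F\<close> is the equation that defines
  \<open>L\<close>, so a double functor over \<open>F\<^sub>0\<close> has no freedom left on
  horizontal morphisms and squares.\<close>

lemma left_adjoint_unique:
  assumes F: "double_functor X A F" and "vertical_part F = F\<^sub>0"
    and nat: "hor_nat_trans X X (dfun_id X) (dfun_comp X F G) \<eta>"
  shows "F = L"
proof -
  interpret F: double_functor X A F by (rule F)
  interpret unit: hor_nat_trans X X "dfun_id X" "dfun_comp X F G" \<eta> by (rule nat)
  have [simp]: "fobj F = on_ob F\<^sub>0" "fver F = on_ar F\<^sub>0"
    using assms(2) by (auto simp: vertical_part_def)
  show ?thesis
  proof (rule dfun_eqI[OF F double_functor_left_adjoint])
    show "fhor F f = fhor L f" if "f \<in> Hor X" for f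
      using that unit.natural_hor[of f]
      by (intro fhor_left_adjoint_eqI[symmetric]) auto
    show "fsq F \<chi> = fsq L \<chi>" if "\<chi> \<in> Sq X" for \<chi>
      using that unit.natural[of \<chi>]
      by (intro fsq_left_adjoint_eqI[symmetric]) auto
  qed (use assms in simp)
qed

text \<open>The singleton set expresses existence and uniqueness of the solution at once.\<close>

lemma fsq_left_adjoint_unique:
  assumes "\<chi> \<in> Sq X"
  shows "{\<beta> \<in> sqs A (on_ar F\<^sub>0 (sleft X \<chi>)) (on_ar F\<^sub>0 (sright X \<chi>)).
      flat (sleft X \<chi>) \<beta> = hsq X \<chi> (on_ar \<eta> (sright X \<chi>))} = {fsq L \<chi>}"
  using assms fsq_left_adjoint_eqI by (auto simp: sqs_def)

end

section \<open>Universality of the unit of an adjunction\<close>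

context hor_double_adjunction
begin

lemma unit_natural_hor:
  "f \<in> Hor X \<Longrightarrow> hcmp X (on_ob \<eta> (hdom X f)) (fhor G (fhor F f)) = hcmp X f (on_ob \<eta> (hcod X f))"
  using unit.natural_hor[of f] by simp

lemma unit_natural:
  "\<chi> \<in> Sq X \<Longrightarrow> hsq X (on_ar \<eta> (sleft X \<chi>)) (fsq G (fsq F \<chi>)) = hsq X \<chi> (on_ar \<eta> (sright X \<chi>))"
  using unit.natural[of \<chi>] by simp

lemma counit_natural_hor:
  "g \<in> Hor A \<Longrightarrow> hcmp A (fhor F (fhor G g)) (on_ob \<epsilon> (hcod A g)) = hcmp A (on_ob \<epsilon> (hdom A g)) g"
  using counit.natural_hor[of g] by simp

lemma counit_natural:
  "\<alpha> \<in> Sq A \<Longrightarrow> hsq A (fsq F (fsq G \<alpha>)) (on_ar \<epsilon> (sright A \<alpha>)) = hsq A (on_ar \<epsilon> (sleft A \<alpha>)) \<alpha>"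
  using counit.natural[of \<alpha>] by simp

lemma triangle_F_hor:
  assumes "x \<in> Obj X"
  shows "hcmp A (fhor F (on_ob \<eta> x)) (on_ob \<epsilon> (fobj F x)) = hid A (fobj F x)"
  using fun_cong[OF arg_cong[OF triangle_F, of on_ob], of x] assms
  by (simp add: trans_comp_def whisker_after_def whisker_before_def trans_id_def)

lemma triangle_F_sq:
  assumes "j \<in> Ver X"
  shows "hsq A (fsq F (on_ar \<eta> j)) (on_ar \<epsilon> (fver F j)) = sqhid A (fver F j)"
  using fun_cong[OF arg_cong[OF triangle_F, of on_ar], of j] assms
  by (simp add: trans_comp_def whisker_after_def whisker_before_def trans_id_def)

lemma triangle_G_hor:
  assumes "a \<in> Obj A"
  shows "hcmp X (on_ob \<eta> (fobj G a)) (fhor G (on_ob \<epsilon> a)) = hid X (fobj G a)"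
  using fun_cong[OF arg_cong[OF triangle_G, of on_ob], of a] assms
  by (simp add: trans_comp_def whisker_after_def whisker_before_def trans_id_def)

lemma triangle_G_sq:
  assumes "k \<in> Ver A"
  shows "hsq X (on_ar \<eta> (fver G k)) (fsq G (on_ar \<epsilon> k)) = sqhid X (fver G k)"
  using fun_cong[OF arg_cong[OF triangle_G, of on_ar], of k] assms
  by (simp add: trans_comp_def whisker_after_def whisker_before_def trans_id_def)

text \<open>The inverse transposes back with the counit, and the triangle identities cancel the two
  round trips. This version for horizontal morphisms supplies the components at objects of the
  presheaf isomorphism.\<close>

lemma bij_betw_flat_hor:
  assumes "x \<in> Obj X" "a \<in> Obj A"
  shows "bij_betw (\<lambda>h. hcmp X (on_ob \<eta> x) (fhor G h)) (hors A (fobj F x) a) (hors X x (fobj G a))"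
proof (rule bij_betw_byWitness[where f' = "\<lambda>f. hcmp A (fhor F f) (on_ob \<epsilon> a)"])
  have "hcmp A (fhor F (hcmp X (on_ob \<eta> x) (fhor G h))) (on_ob \<epsilon> a) = h"
    if h: "h \<in> Hor A" "hdom A h = fobj F x" "hcod A h = a" for h
  proof -
    have "hcmp A (hcmp A (fhor F (on_ob \<eta> x)) (fhor F (fhor G h))) (on_ob \<epsilon> a)
        = hcmp A (hcmp A (fhor F (on_ob \<eta> x)) (on_ob \<epsilon> (fobj F x))) h"
      using h assms counit_natural_hor[of h] by simp
    then show ?thesis using h assms by (simp add: triangle_F_hor del: counit.F.D.hor.assoc)
  qed
  then show "\<forall>h\<in>hors A (fobj F x) a. hcmp A (fhor F (hcmp X (on_ob \<eta> x) (fhor G h))) (on_ob \<epsilon> a) = h"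
    by (simp add: hors_def)
  have "hcmp X (on_ob \<eta> x) (fhor G (hcmp A (fhor F f) (on_ob \<epsilon> a))) = f"
    if f: "f \<in> Hor X" "hdom X f = x" "hcod X f = fobj G a" for f
  proof -
    have "hcmp X (hcmp X (on_ob \<eta> x) (fhor G (fhor F f))) (fhor G (on_ob \<epsilon> a))
        = hcmp X f (hcmp X (on_ob \<eta> (fobj G a)) (fhor G (on_ob \<epsilon> a)))"
      using f assms unit_natural_hor[of f] by (simp del: unit.F.D.hor.assoc) simp
    then show ?thesis using f assms by (simp add: triangle_G_hor)
  qed
  then show "\<forall>f\<in>hors X x (fobj G a). hcmp X (on_ob \<eta> x) (fhor G (hcmp A (fhor F f) (on_ob \<epsilon> a))) = f"
    by (simp add: hors_def)
qed (use assms in \<open>auto simp: hors_def\<close>)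

lemma bij_betw_flat:
  assumes "j \<in> Ver X" "k \<in> Ver A"
  shows "bij_betw (\<lambda>\<beta>. hsq X (on_ar \<eta> j) (fsq G \<beta>)) (sqs A (fver F j) k) (sqs X j (fver G k))"
proof (rule bij_betw_byWitness[where f' = "\<lambda>\<tau>. hsq A (fsq F \<tau>) (on_ar \<epsilon> k)"])
  have "hsq A (fsq F (hsq X (on_ar \<eta> j) (fsq G \<beta>))) (on_ar \<epsilon> k) = \<beta>"
    if \<beta>: "\<beta> \<in> Sq A" "sleft A \<beta> = fver F j" "sright A \<beta> = k" for \<beta>
  proof -
    have "hsq A (hsq A (fsq F (on_ar \<eta> j)) (fsq F (fsq G \<beta>))) (on_ar \<epsilon> k)
        = hsq A (hsq A (fsq F (on_ar \<eta> j)) (on_ar \<epsilon> (fver F j))) \<beta>"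
      using \<beta> assms counit_natural[of \<beta>] by simp
    then show ?thesis using \<beta> assms by (simp add: triangle_F_sq del: counit.F.D.hsq.assoc)
  qed
  then show "\<forall>\<beta>\<in>sqs A (fver F j) k. hsq A (fsq F (hsq X (on_ar \<eta> j) (fsq G \<beta>))) (on_ar \<epsilon> k) = \<beta>"
    by (simp add: sqs_def)
  have "hsq X (on_ar \<eta> j) (fsq G (hsq A (fsq F \<tau>) (on_ar \<epsilon> k))) = \<tau>"
    if \<tau>: "\<tau> \<in> Sq X" "sleft X \<tau> = j" "sright X \<tau> = fver G k" for \<tau>
  proof -
    have "hsq X (hsq X (on_ar \<eta> j) (fsq G (fsq F \<tau>))) (fsq G (on_ar \<epsilon> k))
        = hsq X \<tau> (hsq X (on_ar \<eta> (fver G k)) (fsq G (on_ar \<epsilon> k)))"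
      using \<tau> assms unit_natural[of \<tau>] by (simp del: unit.F.D.hsq.assoc) simp
    then show ?thesis using \<tau> assms by (simp add: triangle_G_sq)
  qed
  then show "\<forall>\<tau>\<in>sqs X j (fver G k). hsq X (on_ar \<eta> j) (fsq G (hsq A (fsq F \<tau>) (on_ar \<epsilon> k))) = \<tau>"
    by (simp add: sqs_def)
qed (use assms in \<open>auto simp: sqs_def\<close>)

lemma unit_universal:
  assumes "j \<in> Ver X"
  shows "universal_from A X G j (fver F j) (on_ar \<eta> j)"
proof -
  have "on_ar \<eta> j \<in> sqs X j (fver G (fver F j))" using assms by (simp add: sqs_def)
  with assms show ?thesis by (simp add: universal_from_def bij_betw_flat)
qed

lemma universal_unit: "universal_unit X A G (vertical_part F) \<eta>"
proof (intro universal_unit.intro universal_unit_axioms.intro)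
  show "double_category X" "double_functor A X G" ..
  show "cfunctor (ObjVer X) (ObjVer A) (vertical_part F)" by (rule F.obj_ver)
  show "cfunctor (ObjVer X) (HorSq X) \<eta>" by (rule unit.cfunctor)
qed (auto simp: sqs_def unit_universal)

lemma left_adjoint_eq: "universal_unit.left_adjoint X A G (vertical_part F) \<eta> = F"
  by (rule universal_unit.left_adjoint_unique[OF universal_unit F.double_functor_axioms refl
        unit.hor_nat_trans_axioms, symmetric])

text \<open>Both counits satisfy the triangle identity at \<open>G\<close>, and universality of the
  unit leaves only one solution. Forgetting the counit therefore loses no information.\<close>

lemma counit_eq: "universal_unit.counit X A G (vertical_part F) \<eta> = \<epsilon>"
proof -
  interpret U: universal_unit X A G "vertical_part F" \<eta> by (rule universal_unit)
  \<comment> \<open>Identifying the constructed left adjoint with \<open>F\<close> puts both counits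
    between the same double functors.\<close>
  interpret U': hor_double_adjunction X A F G \<eta> U.counit
    using U.adjunction by (simp add: left_adjoint_eq)
  show ?thesis
  proof (rule trans_eqI)
    show "on_ob U.counit a = on_ob \<epsilon> a" if "a \<in> Obj A" for a
      using that triangle_G_hor[of a] by (intro U.hor_inject[of "fobj G a"]) auto
    show "on_ar U.counit k = on_ar \<epsilon> k" if "k \<in> Ver A" for k
      using that triangle_G_sq[of k] by (intro U.flat_inject[of "fver G k"]) auto
  qed unfold_locales
qed

end

section \<open>Adjunctions as universal units\<close>

lemma universal_unit_data_iff:
  assumes "double_category X" "double_category A"
  shows "(G, F\<^sub>0, \<eta>) \<in> universal_unit_data X A \<longleftrightarrow> universal_unit X A G F\<^sub>0 \<eta>"
proof
  assume "universal_unit X A G F\<^sub>0 \<eta>"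
  then interpret universal_unit X A G F\<^sub>0 \<eta> .
  show "(G, F\<^sub>0, \<eta>) \<in> universal_unit_data X A"
    using G.double_functor_axioms F\<^sub>0 unit unit_in universal
    by (auto simp: universal_unit_data_def hors_def intro: G.double_functor_axioms)
qed (auto simp: universal_unit_data_def assms intro!: universal_unit.intro universal_unit_axioms.intro)

text \<open>From an adjunction and back, the forgotten parts return by uniqueness of left adjoint
  and counit; the other round trip works because the constructed left adjoint lies over
  \<open>F\<^sub>0\<close>.\<close>

lemma bij_betw_universal_unit_data:
  fixes X :: "('o, 'h, 'v, 's) dbl" and A :: "('p, 'k, 'w, 't) dbl"
  assumes "double_category X" "double_category A"
  shows "bij_betw (\<lambda>(F, G, \<eta>, \<epsilon>). (G, vertical_part F, \<eta>)) (adjunctions X A) (universal_unit_data X A)"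
  by (rule bij_betw_byWitness[where f' = "\<lambda>(G, F\<^sub>0, \<eta>).
        (universal_unit.left_adjoint X A G F\<^sub>0 \<eta>, G, \<eta>, universal_unit.counit X A G F\<^sub>0 \<eta>)"])
    (auto simp: adjunctions_def universal_unit_data_iff[OF assms] universal_unit.adjunction
      universal_unit.vertical_part_left_adjoint hor_double_adjunction.universal_unit
      hor_double_adjunction.left_adjoint_eq hor_double_adjunction.counit_eq)

lemma universal_unit_data_squares:
  assumes "double_category X" "double_category A" "(G, F\<^sub>0, \<eta>) \<in> universal_unit_data X A"
  shows "\<exists>F \<epsilon>. hor_double_adjunction X A F G \<eta> \<epsilon> \<and> vertical_part F = F\<^sub>0 \<and>
    (\<forall>\<chi>\<in>Sq X. {\<beta> \<in> sqs A (on_ar F\<^sub>0 (sleft X \<chi>)) (on_ar F\<^sub>0 (sright X \<chi>)).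
       hsq X (on_ar \<eta> (sleft X \<chi>)) (fsq G \<beta>) = hsq X \<chi> (on_ar \<eta> (sright X \<chi>))} = {fsq F \<chi>})"
proof -
  interpret universal_unit X A G F\<^sub>0 \<eta> using assms by (simp add: universal_unit_data_iff)
  show ?thesis
    using adjunction vertical_part_left_adjoint fsq_left_adjoint_unique by blast
qed

text \<open>The vertical part of \<open>F\<close> and \<eta> form a universal unit; naturality of
  \<eta> then identifies the left adjoint built from them with the given \<open>F\<close>.\<close>

lemma unit_data_adjunction:
  assumes "(F, G, \<eta>) \<in> unit_data X A"
  shows "hor_double_adjunction X A F G \<eta> (universal_unit.counit X A G (vertical_part F) \<eta>)"
proof -
  have F: "double_functor X A F" and G: "double_functor A X G"
    and nat: "hor_nat_trans X X (dfun_id X) (dfun_comp X F G) \<eta>"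
    and u: "j \<in> Ver X \<Longrightarrow> universal_from A X G j (fver F j) (on_ar \<eta> j)" for j
    using assms by (auto simp: unit_data_def)
  interpret F: double_functor X A F by (rule F)
  interpret U: universal_unit X A G "vertical_part F" \<eta>
    by (intro universal_unit.intro universal_unit_axioms.intro)
      (use u in \<open>auto simp: G F.obj_ver F.D.double_category_axioms hor_nat_trans.cfunctor[OF nat]
        universal_from_def\<close>)
  show ?thesis using U.adjunction U.left_adjoint_unique[OF F refl nat] by metis
qed

lemma bij_betw_unit_data:
  fixes X :: "('o, 'h, 'v, 's) dbl" and A :: "('p, 'k, 'w, 't) dbl"
  shows "bij_betw (\<lambda>(F, G, \<eta>, \<epsilon>). (F, G, \<eta>)) (adjunctions X A) (unit_data X A)"
proof -
  have "(F, G, \<eta>) \<in> unit_data X A" if "hor_double_adjunction X A F G \<eta> \<epsilon>" for F G \<eta> \<epsilon>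
  proof -
    interpret hor_double_adjunction X A F G \<eta> \<epsilon> by (rule that)
    have "hor_nat_trans X X (dfun_id X) (dfun_comp X F G) \<eta>" ..
    then show ?thesis
      by (auto simp: unit_data_def unit_universal
          F.double_functor_axioms G.double_functor_axioms)
  qed
  then show ?thesis
    by (intro bij_betw_byWitness[where f' = "\<lambda>(F, G, \<eta>).
          (F, G, \<eta>, universal_unit.counit X A G (vertical_part F) \<eta>)"])
      (auto simp: adjunctions_def unit_data_adjunction hor_double_adjunction.counit_eq)
qed

section \<open>Horizontal duality\<close>

lemma horop_simps [simp]:
  "Obj (horop D) = Obj D" "Hor (horop D) = Hor D" "Ver (horop D) = Ver D" "Sq (horop D) = Sq D"
  "hdom (horop D) = hcod D" "hcod (horop D) = hdom D" "hid (horop D) = hid D"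
  "hcmp (horop D) f g = hcmp D g f"
  "vdom (horop D) = vdom D" "vcod (horop D) = vcod D" "vid (horop D) = vid D" "vcmp (horop D) = vcmp D"
  "sleft (horop D) = sright D" "sright (horop D) = sleft D" "sqhid (horop D) = sqhid D"
  "hsq (horop D) \<alpha> \<beta> = hsq D \<beta> \<alpha>"
  "stop (horop D) = stop D" "sbot (horop D) = sbot D" "sqvid (horop D) = sqvid D" "vsq (horop D) = vsq D"
  by (simp_all add: horop_def)

lemma horop_horop [simp]: "horop (horop D) = D"
  by (simp add: horop_def)

lemma sqs_horop [simp]: "sqs (horop D) j k = sqs D k j"
  and hors_horop [simp]: "hors (horop D) x y = hors D y x"
  by (auto simp: sqs_def hors_def)

lemma ObjVer_horop [simp]: "ObjVer (horop D) = ObjVer D"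
  and HorSq_horop [simp]: "HorSq (horop D) = HorSq D"
  by (simp_all add: ObjVer_def HorSq_def)

lemma dfun_horop [simp]: "dfun_id (horop D) = dfun_id D" "dfun_comp (horop D) = dfun_comp D"
  by (simp_all add: dfun_id_def dfun_comp_def fun_eq_iff)

lemma double_category_horop:
  assumes "double_category D"
  shows "double_category (horop D)"
proof -
  interpret double_category D by fact
  have "category (ObjHor (horop D))" "category (VerSq (horop D))"
    by (unfold_locales; simp add: ObjHor_def VerSq_def)+
  with ObjVer HorSq show ?thesis
    by (intro double_category.intro) (auto simp: sqhid_vcmp sqvid_hcmp interchange)
qed

lemma double_functor_horop:
  assumes "double_functor D C F"
  shows "double_functor (horop D) (horop C) F"
proof -
  interpret F: double_functor D C F by fact
  interpret D: double_category "horop D" by (intro double_category_horop) unfold_locales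
  interpret C: double_category "horop C" by (intro double_category_horop) unfold_locales
  have "cfunctor (ObjHor (horop D)) (ObjHor (horop C)) \<lparr>on_ob = fobj F, on_ar = fhor F\<rparr>"
    using D.ObjHor C.ObjHor F.hor.ob F.hor.ar
    by (intro cfunctor.intro cfunctor_axioms.intro) (auto simp: ObjHor_def)
  moreover have "cfunctor (VerSq (horop D)) (VerSq (horop C)) \<lparr>on_ob = fver F, on_ar = fsq F\<rparr>"
    using D.VerSq C.VerSq F.hsq.ob F.hsq.ar
    by (intro cfunctor.intro cfunctor_axioms.intro) (auto simp: VerSq_def)
  ultimately show ?thesis
    using F.obj_ver F.hor_sq
    by (intro double_functor.intro double_functor_axioms.intro)
      (auto intro: D.double_category_axioms C.double_category_axioms)
qed

lemma hor_nat_trans_horop: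
  assumes "hor_nat_trans D C F G \<theta>"
  shows "hor_nat_trans (horop D) (horop C) G F \<theta>"
proof -
  interpret hor_nat_trans D C F G \<theta> by fact
  show ?thesis
    by (intro hor_nat_trans.intro hor_nat_trans_axioms.intro double_functor_horop)
      (use ext_ob ext_ar at_ob at_ver in \<open>auto intro: F.double_functor_axioms G.double_functor_axioms
        simp: natural\<close>)
qed

text \<open>Double functors keep their direction while transformations turn around. Hence the two
  adjoints trade places, as do unit and counit, and each triangle identity of the opposite is the
  other one of the original.\<close>

lemma hor_double_adjunction_horop:
  assumes "hor_double_adjunction X A F G \<eta> \<epsilon>"
  shows "hor_double_adjunction (horop A) (horop X) G F \<epsilon> \<eta>"
proof -
  interpret hor_double_adjunction X A F G \<eta> \<epsilon> by fact
  show ?thesis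
  proof (intro hor_double_adjunction.intro hor_double_adjunction_axioms.intro)
    show "double_functor (horop A) (horop X) G" "double_functor (horop X) (horop A) F"
      by (intro double_functor_horop F.double_functor_axioms G.double_functor_axioms)+
    show "hor_nat_trans (horop A) (horop A) (dfun_id (horop A)) (dfun_comp (horop A) G F) \<epsilon>"
      using hor_nat_trans_horop[OF counit.hor_nat_trans_axioms] by simp
    show "hor_nat_trans (horop X) (horop X) (dfun_comp (horop X) F G) (dfun_id (horop X)) \<eta>"
      using hor_nat_trans_horop[OF unit.hor_nat_trans_axioms] by simp
    show "trans_comp (horop A) (horop X) (whisker_after (horop A) \<epsilon> G) (whisker_before (horop A) G \<eta>)
        = trans_id (horop A) (horop X) G"
      using triangle_G by (simp add: trans_comp_def whisker_after_def whisker_before_def trans_id_def)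
    show "trans_comp (horop X) (horop A) (whisker_before (horop X) F \<epsilon>) (whisker_after (horop X) \<eta> F)
        = trans_id (horop X) (horop A) F"
      using triangle_F by (simp add: trans_comp_def whisker_after_def whisker_before_def trans_id_def)
  qed
qed

lemma hor_double_adjunction_horop_iff:
  "hor_double_adjunction (horop A) (horop X) G F \<epsilon> \<eta> \<longleftrightarrow> hor_double_adjunction X A F G \<eta> \<epsilon>"
  using hor_double_adjunction_horop[of X A F G \<eta> \<epsilon>]
    hor_double_adjunction_horop[of "horop A" "horop X" G F \<epsilon> \<eta>] by auto

lemma double_functor_horop_iff: "double_functor (horop D) (horop C) F \<longleftrightarrow> double_functor D C F"
  using double_functor_horop[of D C F] double_functor_horop[of "horop D" "horop C" F] by auto

lemma hor_nat_trans_horop_iff: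
  "hor_nat_trans (horop D) (horop C) G F \<theta> \<longleftrightarrow> hor_nat_trans D C F G \<theta>"
  using hor_nat_trans_horop[of D C F G \<theta>] hor_nat_trans_horop[of "horop D" "horop C" G F \<theta>] by auto

lemma universal_from_horop:
  "universal_from (horop X) (horop A) F k j \<mu> \<longleftrightarrow> universal_to X A F j k \<mu>"
  by (auto simp: universal_from_def universal_to_def)

lemma bij_betw_adjunctions_horop:
  "bij_betw (\<lambda>(F, G, \<eta>, \<epsilon>). (G, F, \<epsilon>, \<eta>)) (adjunctions X A) (adjunctions (horop A) (horop X))"
  by (rule bij_betw_byWitness[where f' = "\<lambda>(G, F, \<epsilon>, \<eta>). (F, G, \<eta>, \<epsilon>)"])
    (auto simp: adjunctions_def hor_double_adjunction_horop_iff)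

text \<open>Counit data are unit data of the opposites up to the order of the two double functors,
  so three bijections are composed.\<close>

lemma bij_betw_counit_data:
  fixes X :: "('o, 'h, 'v, 's) dbl" and A :: "('p, 'k, 'w, 't) dbl"
  shows "bij_betw (\<lambda>(F, G, \<eta>, \<epsilon>). (F, G, \<epsilon>)) (adjunctions X A) (counit_data X A)"
proof -
  have "bij_betw (\<lambda>(G, F, \<epsilon>). (F, G, \<epsilon>)) (unit_data (horop A) (horop X)) (counit_data X A)"
    by (rule bij_betw_byWitness[where f' = "\<lambda>(F, G, \<epsilon>). (G, F, \<epsilon>)"])
      (auto simp: unit_data_def counit_data_def double_functor_horop_iff universal_from_horop
        hor_nat_trans_horop_iff)
  with bij_betw_adjunctions_horop bij_betw_unit_data
  have "bij_betw ((\<lambda>(G, F, \<epsilon>). (F, G, \<epsilon>)) \<circ> ((\<lambda>(G, F, \<epsilon>, \<eta>). (G, F, \<epsilon>)) \<circ> (\<lambda>(F, G, \<eta>, \<epsilon>). (G, F, \<epsilon>, \<eta>))))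
      (adjunctions X A) (counit_data X A)"
    by (intro bij_betw_trans)
  then show ?thesis by (simp add: comp_def case_prod_unfold)
qed

text \<open>An equality of sets, since both kinds of triples begin with the double functor that is
  fully given.\<close>

lemma universal_unit_data_horop:
  "universal_unit_data (horop A) (horop X) = universal_counit_data X A"
  by (auto simp: universal_unit_data_def universal_counit_data_def double_functor_horop_iff
      universal_from_horop)

lemma bij_betw_universal_counit_data:
  fixes X :: "('o, 'h, 'v, 's) dbl" and A :: "('p, 'k, 'w, 't) dbl"
  assumes "double_category X" "double_category A"
  shows "bij_betw (\<lambda>(F, G, \<eta>, \<epsilon>). (F, vertical_part G, \<epsilon>)) (adjunctions X A) (universal_counit_data X A)"
  using bij_betw_trans[OF bij_betw_adjunctions_horop[of X A]
      bij_betw_universal_unit_data[of "horop A" "horop X"]]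
  by (simp add: comp_def case_prod_unfold universal_unit_data_horop double_category_horop assms)

lemma universal_counit_data_squares:
  assumes "double_category X" "double_category A" "(F, G\<^sub>0, \<epsilon>) \<in> universal_counit_data X A"
  shows "\<exists>G \<eta>. hor_double_adjunction X A F G \<eta> \<epsilon> \<and> vertical_part G = G\<^sub>0 \<and>
    (\<forall>\<alpha>\<in>Sq A. {\<beta> \<in> sqs X (on_ar G\<^sub>0 (sleft A \<alpha>)) (on_ar G\<^sub>0 (sright A \<alpha>)).
       hsq A (fsq F \<beta>) (on_ar \<epsilon> (sright A \<alpha>)) = hsq A (on_ar \<epsilon> (sleft A \<alpha>)) \<alpha>} = {fsq G \<alpha>})"
  using universal_unit_data_squares[of "horop A" "horop X" F G\<^sub>0 \<epsilon>] assms
  by (simp add: universal_unit_data_horop double_category_horop hor_double_adjunction_horop_iff)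

section \<open>Bijections between sets of squares\<close>

text \<open>As \<phi> acts on squares only, a component at an object has to be read off as the top
  of the square at its vertical identity.\<close>

definition hom_unit ::
  "('o, 'h, 'v, 's) dbl \<Rightarrow> ('p, 'k, 'w, 't) dbl \<Rightarrow> ('o, 'h, 'v, 's, 'p, 'k, 'w, 't) dfun \<Rightarrow>
   ('v \<times> 'w \<Rightarrow> 't \<Rightarrow> 's) \<Rightarrow> ('o, 'v, 'h, 's) trans" where
  "hom_unit X A F \<phi> =
     \<lparr>on_ob = (\<lambda>x\<in>Obj X. stop X (\<phi> (vid X x, fver F (vid X x)) (sqhid A (fver F (vid X x))))),
      on_ar = (\<lambda>j\<in>Ver X. \<phi> (j, fver F j) (sqhid A (fver F j)))\<rparr>"

text \<open>Extensionality of \<phi> is kept apart; it enters only when \<phi> is recovered as a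
  function from its unit.\<close>

locale hom_bijection = F: double_functor X A F + G: double_functor A X G
  for X :: "('o, 'h, 'v, 's) dbl" and A :: "('p, 'k, 'w, 't) dbl"
    and F :: "('o, 'h, 'v, 's, 'p, 'k, 'w, 't) dfun"
    and G :: "('p, 'k, 'w, 't, 'o, 'h, 'v, 's) dfun" +
  fixes \<phi> :: "'v \<times> 'w \<Rightarrow> 't \<Rightarrow> 's"
  assumes bij: "\<lbrakk>j \<in> Ver X; k \<in> Ver A\<rbrakk> \<Longrightarrow> bij_betw (\<phi> (j, k)) (sqs A (fver F j) k) (sqs X j (fver G k))"
    and natural_left: "\<lbrakk>j' \<in> Ver X; j \<in> Ver X; k \<in> Ver A; \<sigma> \<in> sqs X j' j; \<alpha> \<in> sqs A (fver F j) k\<rbrakk>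
      \<Longrightarrow> \<phi> (j', k) (hsq A (fsq F \<sigma>) \<alpha>) = hsq X \<sigma> (\<phi> (j, k) \<alpha>)"
    and natural_right: "\<lbrakk>j \<in> Ver X; k \<in> Ver A; k' \<in> Ver A; \<alpha> \<in> sqs A (fver F j) k; \<tau> \<in> sqs A k k'\<rbrakk>
      \<Longrightarrow> \<phi> (j, k') (hsq A \<alpha> \<tau>) = hsq X (\<phi> (j, k) \<alpha>) (fsq G \<tau>)"
    and composable: "\<lbrakk>j \<in> Ver X; j' \<in> Ver X; k \<in> Ver A; k' \<in> Ver A; \<alpha> \<in> sqs A (fver F j) k;
        \<beta> \<in> sqs A (fver F j') k'; vcod X j = vdom X j'; vcod A k = vdom A k'; sbot A \<alpha> = stop A \<beta>\<rbrakk>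
      \<Longrightarrow> sbot X (\<phi> (j, k) \<alpha>) = stop X (\<phi> (j', k') \<beta>)"
    and vertical: "\<lbrakk>j \<in> Ver X; j' \<in> Ver X; k \<in> Ver A; k' \<in> Ver A; \<alpha> \<in> sqs A (fver F j) k;
        \<beta> \<in> sqs A (fver F j') k'; vcod X j = vdom X j'; vcod A k = vdom A k'; sbot A \<alpha> = stop A \<beta>\<rbrakk>
      \<Longrightarrow> \<phi> (vcmp X j j', vcmp A k k') (vsq A \<alpha> \<beta>) = vsq X (\<phi> (j, k) \<alpha>) (\<phi> (j', k') \<beta>)"
begin

definition unit_sq :: "'v \<Rightarrow> 's" where
  "unit_sq j = \<phi> (j, fver F j) (sqhid A (fver F j))"

definition unit_hor :: "'o \<Rightarrow> 'h" where
  "unit_hor x = stop X (unit_sq (vid X x))"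

lemma sqhid_in: "j \<in> Ver X \<Longrightarrow> sqhid A (fver F j) \<in> sqs A (fver F j) (fver F j)"
  by (simp add: sqs_def)

lemma unit_sq_simps [simp]:
  assumes "j \<in> Ver X"
  shows "unit_sq j \<in> Sq X" "sleft X (unit_sq j) = j" "sright X (unit_sq j) = fver G (fver F j)"
  using bij_betwE[OF bij[of j "fver F j"]] sqhid_in[of j] assms by (auto simp: sqs_def unit_sq_def)

text \<open>The Yoneda argument: \<alpha> is an identity square followed by \<alpha>, and naturality
  on the right pulls \<alpha> out.\<close>

lemma phi_eq:
  assumes "j \<in> Ver X" "k \<in> Ver A" "\<alpha> \<in> sqs A (fver F j) k"
  shows "\<phi> (j, k) \<alpha> = hsq X (unit_sq j) (fsq G \<alpha>)"
  using natural_right[of j "fver F j" k "sqhid A (fver F j)" \<alpha>] assms by (simp add: sqs_def unit_sq_def)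

lemma unit_sq_bij:
  assumes "j \<in> Ver X" "k \<in> Ver A"
  shows "bij_betw (\<lambda>\<alpha>. hsq X (unit_sq j) (fsq G \<alpha>)) (sqs A (fver F j) k) (sqs X j (fver G k))"
  using bij[OF assms] phi_eq[OF assms] by (simp cong: bij_betw_cong)

text \<open>Both sides are \<phi> of \<open>fsq F \<chi>\<close>, once by naturality on the left and
  once by \<open>phi_eq\<close>.\<close>

lemma unit_sq_natural:
  assumes "\<chi> \<in> Sq X"
  shows "hsq X \<chi> (unit_sq (sright X \<chi>)) = hsq X (unit_sq (sleft X \<chi>)) (fsq G (fsq F \<chi>))"
proof -
  have "hsq X \<chi> (unit_sq (sright X \<chi>))
      = \<phi> (sleft X \<chi>, fver F (sright X \<chi>)) (hsq A (fsq F \<chi>) (sqhid A (fver F (sright X \<chi>))))"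
    using assms unfolding unit_sq_def by (intro natural_left[symmetric]) (auto simp: sqs_def)
  also have "\<dots> = hsq X (unit_sq (sleft X \<chi>)) (fsq G (fsq F \<chi>))"
    using assms by (subst phi_eq) (simp_all add: sqs_def)
  finally show ?thesis .
qed

lemma unit_sq_composable:
  assumes "j \<in> Ver X" "j' \<in> Ver X" "vcod X j = vdom X j'"
  shows "sbot X (unit_sq j) = stop X (unit_sq j')"
  using assms unfolding unit_sq_def by (intro composable) (auto simp: sqs_def)

lemma unit_hor_simps [simp]:
  assumes "x \<in> Obj X"
  shows "unit_hor x \<in> Hor X" "hdom X (unit_hor x) = x" "hcod X (unit_hor x) = fobj G (fobj F x)"
  using assms by (simp_all add: unit_hor_def)

text \<open>A vertical identity is composable both with \<open>j\<close> and with itself. The bottom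
  of its unit square thus equals the top of \<open>unit_sq j\<close> as well as its own top, which
  is \<open>unit_hor\<close>.\<close>

lemma unit_sq_top [simp]: "j \<in> Ver X \<Longrightarrow> stop X (unit_sq j) = unit_hor (vdom X j)"
  using unit_sq_composable[of "vid X (vdom X j)" j]
    unit_sq_composable[of "vid X (vdom X j)" "vid X (vdom X j)"] by (simp add: unit_hor_def)

lemma unit_sq_bot [simp]: "j \<in> Ver X \<Longrightarrow> sbot X (unit_sq j) = unit_hor (vcod X j)"
  using unit_sq_composable[of j "vid X (vcod X j)"] by simp

lemma unit_sq_vcmp:
  assumes "j \<in> Ver X" "j' \<in> Ver X" "vcod X j = vdom X j'"
  shows "unit_sq (vcmp X j j') = vsq X (unit_sq j) (unit_sq j')"
  using vertical[of j j' "fver F j" "fver F j'" "sqhid A (fver F j)" "sqhid A (fver F j')"] assms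
  by (simp add: sqs_def unit_sq_def F.C.sqhid_vcmp)

text \<open>
  Compatibility with vertical identities is not assumed in \<open>hom_bijection\<close>. It follows because
  \<open>unit_sq (vid X x)\<close> and \<open>sqvid X (unit_hor x)\<close> have the same preimage under \<open>\<phi>\<close>. The
  preimage of the latter is computed with the squares \<open>\<beta>\<close> that \<open>\<phi>\<close> sends to horizontal
  identities, which are themselves vertical identities by the next lemma.
\<close>

lemma identity_preimage:
  assumes a: "a \<in> Obj A"
  obtains p where "p \<in> hors A (fobj F (fobj G a)) a"
    and "\<phi> (vid X (fobj G a), vid A a) (sqvid A p) = sqvid X (hid X (fobj G a))"
proof -
  let ?x = "fobj G a" and ?i = "sqvid X (hid X (fobj G a))"
  let ?e = "unit_sq (vid X ?x)"
  have x: "?x \<in> Obj X" using a by simp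
  have "?i \<in> sqs X (vid X ?x) (fver G (vid A a))" using a by (simp add: sqs_def)
  then have "?i \<in> (\<lambda>\<beta>. hsq X ?e (fsq G \<beta>)) ` sqs A (fver F (vid X ?x)) (vid A a)"
    using x a by (subst bij_betw_imp_surj_on[OF unit_sq_bij]) simp_all
  then obtain \<beta> where \<beta>: "\<beta> \<in> sqs A (fver F (vid X ?x)) (vid A a)"
    and \<beta>i: "hsq X ?e (fsq G \<beta>) = ?i" by auto
  \<comment> \<open>The sides of \<beta> are vertical identities, but \<beta> itself is not known to
    be a vertical identity square; the one on its top is the candidate replacement.\<close>
  define p where "p = stop A \<beta>"
  have \<beta>': "\<beta> \<in> Sq A" "sleft A \<beta> = fver F (vid X ?x)" "sright A \<beta> = vid A a"
    using \<beta> by (auto simp: sqs_def)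
  have p: "p \<in> Hor A" "hdom A p = fobj F ?x" "hcod A p = a"
    using \<beta>' x a by (auto simp: p_def)
  have ee: "vsq X ?e ?e = ?e"
    using unit_sq_vcmp[of "vid X ?x" "vid X ?x"] x by simp
  have top: "hcmp X (unit_hor ?x) (fhor G p) = hid X ?x"
    using arg_cong[OF \<beta>i, of "stop X"] \<beta>' x by (simp add: p_def)
  \<comment> \<open>Idempotence of \<open>?e\<close> and the identity square stacked on \<beta>
    split the composite into two rows. The lower row is \<open>?i\<close>, a vertical identity, and
    drops out; the remaining row says that \<open>sqvid A p\<close> is sent to \<open>?i\<close> as
    well.\<close>
  have "?i = hsq X (vsq X ?e ?e) (vsq X (fsq G (sqvid A p)) (fsq G \<beta>))"
    using \<beta>i ee \<beta>' p by (simp add: p_def)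
  also have "\<dots> = vsq X (hsq X ?e (fsq G (sqvid A p))) (hsq X ?e (fsq G \<beta>))"
    using \<beta>' p x by (intro F.D.interchange[symmetric]) (auto simp: p_def)
  also have "\<dots> = hsq X ?e (fsq G (sqvid A p))"
    unfolding \<beta>i using p x top by simp
  finally have "\<phi> (vid X ?x, vid A a) (sqvid A p) = ?i"
    using p x a by (subst phi_eq) (auto simp: sqs_def)
  with p show thesis by (intro that[of p]) (auto simp: hors_def)
qed

lemma unit_sq_vid:
  assumes x: "x \<in> Obj X"
  shows "unit_sq (vid X x) = sqvid X (unit_hor x)"
proof -
  let ?u = "unit_hor x" and ?a = "fobj F x" and ?e = "unit_sq (vid X x)"
  have a: "?a \<in> Obj A" using x by simp
  obtain p where p: "p \<in> hors A (fobj F (fobj G ?a)) ?a"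
    and \<phi>p: "\<phi> (vid X (fobj G ?a), vid A ?a) (sqvid A p) = sqvid X (hid X (fobj G ?a))"
    using identity_preimage[OF a] .
  have p': "p \<in> Hor A" "hdom A p = fobj F (fobj G ?a)" "hcod A p = ?a"
    using p by (auto simp: hors_def)
  have u: "?u \<in> Hor X" "hdom X ?u = x" "hcod X ?u = fobj G ?a"
    using x by simp_all
  have e: "?e \<in> sqs X (vid X x) (vid X (fobj G ?a))" using x by (simp add: sqs_def)
  have pin: "sqvid A p \<in> sqs A (fver F (vid X (fobj G ?a))) (vid A ?a)"
    using p' a by (simp add: sqs_def)
  have "\<phi> (vid X x, vid A ?a) (hsq A (fsq F ?e) (sqvid A p))
      = hsq X ?e (\<phi> (vid X (fobj G ?a), vid A ?a) (sqvid A p))"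
    using x e pin by (intro natural_left) auto
  \<comment> \<open>The vertical identity square of a horizontal identity is also a horizontal
    identity square, hence neutral here.\<close>
  also have "\<dots> = ?e" unfolding \<phi>p using x u by (simp flip: F.D.sqhid_vid)
  also have "\<dots> = \<phi> (vid X x, vid A ?a) (sqvid A (hid A ?a))" using x by (simp add: unit_sq_def)
  finally have Fe: "hsq A (fsq F ?e) (sqvid A p) = sqvid A (hid A ?a)"
    using bij_betw_imp_inj_on[OF bij[of "vid X x" "vid A ?a"]] x p'
    by (auto dest!: inj_onD simp: sqs_def)
  \<comment> \<open>Here \<open>p\<close> plays the part of the counit at \<open>?a\<close>: the top
    boundary gives a triangle identity, by which \<open>sqvid X ?u\<close> acquires the same
    preimage as \<open>?e\<close>.\<close>
  have triangle: "hcmp A (fhor F ?u) p = hid A ?a"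
    using arg_cong[OF Fe, of "stop A"] x p' u by simp
  have "sqvid X ?u \<in> sqs X (vid X x) (vid X (fobj G ?a))" using u by (simp add: sqs_def)
  then have "\<phi> (vid X x, vid A ?a) (hsq A (fsq F (sqvid X ?u)) (sqvid A p))
      = hsq X (sqvid X ?u) (\<phi> (vid X (fobj G ?a), vid A ?a) (sqvid A p))"
    using x pin by (intro natural_left) auto
  also have "\<dots> = sqvid X ?u"
    unfolding \<phi>p using x u by (simp flip: F.D.sqhid_vid)
  finally have "\<phi> (vid X x, vid A ?a) (hsq A (fsq F (sqvid X ?u)) (sqvid A p)) = sqvid X ?u" .
  moreover have "hsq A (fsq F (sqvid X ?u)) (sqvid A p) = sqvid A (hid A ?a)"
    using u p' by (simp flip: triangle add: F.C.sqvid_hcmp)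
  ultimately show ?thesis using x by (simp add: unit_sq_def)
qed

lemma hom_unit_in_unit_data: "(F, G, hom_unit X A F \<phi>) \<in> unit_data X A"
proof -
  let ?\<eta> = "hom_unit X A F \<phi>"
  have ob: "on_ob ?\<eta> x = unit_hor x" if "x \<in> Obj X" for x
    using that by (simp add: hom_unit_def unit_sq_def unit_hor_def)
  have ar: "on_ar ?\<eta> j = unit_sq j" if "j \<in> Ver X" for j
    using that by (simp add: hom_unit_def unit_sq_def)
  have "double_functor X X (dfun_id X)" "double_functor X X (dfun_comp X F G)"
    by (auto intro: double_functor_id double_functor_comp F.D.double_category_axioms
        F.double_functor_axioms G.double_functor_axioms)
  then have "hor_nat_trans X X (dfun_id X) (dfun_comp X F G) ?\<eta>"
    by (intro hor_nat_trans.intro hor_nat_trans_axioms.intro)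
      (simp_all add: ob ar hors_def sqs_def unit_sq_vid unit_sq_vcmp unit_sq_natural,
        simp_all add: hom_unit_def)
  moreover have "universal_from A X G j (fver F j) (on_ar ?\<eta> j)" if "j \<in> Ver X" for j
  proof -
    have "unit_sq j \<in> sqs X j (fver G (fver F j))" using that by (simp add: sqs_def)
    then show ?thesis using that by (simp add: ar universal_from_def unit_sq_bij)
  qed
  ultimately show ?thesis
    by (simp add: unit_data_def F.double_functor_axioms G.double_functor_axioms)
qed

end

lemma hom_bijection_data_iff:
  "(F, G, \<phi>) \<in> hom_bijection_data X A \<longleftrightarrow> hom_bijection X A F G \<phi> \<and>
    \<phi> \<in> (\<Pi>\<^sub>E (j, k)\<in>Ver X \<times> Ver A. sqs A (fver F j) k \<rightarrow>\<^sub>E sqs X j (fver G k))"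
  unfolding hom_bijection_data_def hom_bijection_def hom_bijection_axioms_def
    mem_Collect_eq case_prod_conv by (rule iffI; elim conjE; intro conjI allI ballI impI; (elim conjE)?; simp)

lemma hom_bijection_adjunction:
  assumes "hom_bijection X A F G \<phi>"
  shows "hor_double_adjunction X A F G (hom_unit X A F \<phi>)
    (universal_unit.counit X A G (vertical_part F) (hom_unit X A F \<phi>))"
  by (intro unit_data_adjunction hom_bijection.hom_unit_in_unit_data assms)

text \<open>On squares this is \<open>phi_eq\<close>; equality of functions also uses extensionality
  at two levels, in the pair of vertical morphisms and in the square.\<close>

lemma transpose_sq_hom_unit:
  assumes "(F, G, \<phi>) \<in> hom_bijection_data X A"
  shows "transpose_sq X A F G (hom_unit X A F \<phi>) = \<phi>"
proof -
  have ext: "\<phi> \<in> (\<Pi>\<^sub>E (j, k)\<in>Ver X \<times> Ver A. sqs A (fver F j) k \<rightarrow>\<^sub>E sqs X j (fver G k))"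
    using assms by (simp add: hom_bijection_data_iff)
  interpret hom_bijection X A F G \<phi> using assms by (simp add: hom_bijection_data_iff)
  have \<phi>: "\<phi> (j, k) = (\<lambda>\<alpha>\<in>sqs A (fver F j) k. hsq X (unit_sq j) (fsq G \<alpha>))"
    if "j \<in> Ver X" "k \<in> Ver A" for j k
  proof (rule extensionalityI)
    show "\<phi> (j, k) \<in> extensional (sqs A (fver F j) k)"
      using PiE_mem[OF ext, of "(j, k)"] that by (auto simp: PiE_def)
  qed (use that in \<open>auto simp: phi_eq[of j k]\<close>)
  have unit: "on_ar (hom_unit X A F \<phi>) j = unit_sq j" if "j \<in> Ver X" for j
    using that by (simp add: hom_unit_def unit_sq_def)
  show ?thesis
  proof (rule extensionalityI)
    show "\<phi> \<in> extensional (Ver X \<times> Ver A)" using ext by (auto simp: PiE_def)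
    show "transpose_sq X A F G (hom_unit X A F \<phi>) \<in> extensional (Ver X \<times> Ver A)"
      by (simp add: transpose_sq_def)
    show "transpose_sq X A F G (hom_unit X A F \<phi>) jk = \<phi> jk" if "jk \<in> Ver X \<times> Ver A" for jk
      using that by (auto simp: transpose_sq_def unit \<phi>)
  qed
qed

section \<open>Transposition as a natural family of bijections\<close>

context hor_double_adjunction
begin

lemma transpose_sq_hom_bijection_data: "(F, G, transpose_sq X A F G \<eta>) \<in> hom_bijection_data X A"
proof -
  have eq: "transpose_sq X A F G \<eta> (j, k) \<alpha> = hsq X (on_ar \<eta> j) (fsq G \<alpha>)"
    if "j \<in> Ver X" "\<alpha> \<in> Sq A" "sleft A \<alpha> = fver F j" "sright A \<alpha> = k" for j k \<alpha>
    using that by (auto simp: transpose_sq_def sqs_def)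
  have "hom_bijection X A F G (transpose_sq X A F G \<eta>)"
  proof (intro hom_bijection.intro hom_bijection_axioms.intro)
    show "bij_betw (transpose_sq X A F G \<eta> (j, k)) (sqs A (fver F j) k) (sqs X j (fver G k))"
      if "j \<in> Ver X" "k \<in> Ver A" for j k
      using bij_betw_flat[OF that] that by (simp add: transpose_sq_def)
    show "transpose_sq X A F G \<eta> (j', k) (hsq A (fsq F \<sigma>) \<alpha>) = hsq X \<sigma> (transpose_sq X A F G \<eta> (j, k) \<alpha>)"
      if "j' \<in> Ver X" "j \<in> Ver X" "k \<in> Ver A" "\<sigma> \<in> sqs X j' j" "\<alpha> \<in> sqs A (fver F j) k" for j' j k \<sigma> \<alpha>
    proof -
      have m: "\<sigma> \<in> Sq X" "sleft X \<sigma> = j'" "sright X \<sigma> = j" "\<alpha> \<in> Sq A" "sleft A \<alpha> = fver F j" "sright A \<alpha> = k"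
        using that by (auto simp: sqs_def)
      have "hsq X (hsq X (on_ar \<eta> j') (fsq G (fsq F \<sigma>))) (fsq G \<alpha>) = hsq X (hsq X \<sigma> (on_ar \<eta> j)) (fsq G \<alpha>)"
        using unit_natural[of \<sigma>] m by simp
      then show ?thesis using m that by (simp add: eq)
    qed
  qed (auto simp: sqs_def eq F.double_functor_axioms G.double_functor_axioms unit.F.D.interchange)
  moreover have "transpose_sq X A F G \<eta>
      \<in> (\<Pi>\<^sub>E (j, k)\<in>Ver X \<times> Ver A. sqs A (fver F j) k \<rightarrow>\<^sub>E sqs X j (fver G k))"
    by (auto simp: transpose_sq_def sqs_def split: if_splits)
  ultimately show ?thesis by (simp add: hom_bijection_data_iff)
qed

text \<open>Transposing an identity square returns the unit square; at a vertical identity its top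
  is the component at the object.\<close>

lemma hom_unit_transpose_sq: "hom_unit X A F (transpose_sq X A F G \<eta>) = \<eta>"
proof -
  have eq: "transpose_sq X A F G \<eta> (j, fver F j) (sqhid A (fver F j)) = on_ar \<eta> j"
    if "j \<in> Ver X" for j
    using that by (simp add: transpose_sq_def sqs_def)
  have "on_ob (hom_unit X A F (transpose_sq X A F G \<eta>)) x = on_ob \<eta> x" if "x \<in> Obj X" for x
    using that eq[of "vid X x"] by (simp add: hom_unit_def)
  then have "on_ob (hom_unit X A F (transpose_sq X A F G \<eta>)) = on_ob \<eta>"
    by (intro extensionalityI[OF _ unit.ext_ob]) (simp add: hom_unit_def)
  moreover have "on_ar (hom_unit X A F (transpose_sq X A F G \<eta>)) = on_ar \<eta>"
    by (intro extensionalityI[OF _ unit.ext_ar]) (simp_all add: hom_unit_def eq)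
  ultimately show ?thesis by simp
qed

end

lemma bij_betw_hom_bijection_data:
  fixes X :: "('o, 'h, 'v, 's) dbl" and A :: "('p, 'k, 'w, 't) dbl"
  shows "bij_betw (\<lambda>(F, G, \<eta>, \<epsilon>). (F, G, transpose_sq X A F G \<eta>))
    (adjunctions X A) (hom_bijection_data X A)"
  by (rule bij_betw_byWitness[where f' = "\<lambda>(F, G, \<phi>). (F, G, hom_unit X A F \<phi>,
        universal_unit.counit X A G (vertical_part F) (hom_unit X A F \<phi>))"])
    (auto simp: adjunctions_def hor_double_adjunction.hom_unit_transpose_sq
      hor_double_adjunction.counit_eq transpose_sq_hom_unit
      hor_double_adjunction.transpose_sq_hom_bijection_data
      intro: hom_bijection_adjunction[of X A] dest: hom_bijection_data_iff[THEN iffD1])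

section \<open>Parameterized presheaves\<close>

lemma dbl_prod_simps [simp]:
  "Obj (dbl_prod D E) = Obj D \<times> Obj E" "Hor (dbl_prod D E) = Hor D \<times> Hor E"
  "Ver (dbl_prod D E) = Ver D \<times> Ver E" "Sq (dbl_prod D E) = Sq D \<times> Sq E"
  "hdom (dbl_prod D E) (f, f') = (hdom D f, hdom E f')"
  "hcod (dbl_prod D E) (f, f') = (hcod D f, hcod E f')"
  "hid (dbl_prod D E) (x, x') = (hid D x, hid E x')"
  "hcmp (dbl_prod D E) (f, f') (g, g') = (hcmp D f g, hcmp E f' g')"
  "vdom (dbl_prod D E) (j, j') = (vdom D j, vdom E j')"
  "vcod (dbl_prod D E) (j, j') = (vcod D j, vcod E j')"
  "vid (dbl_prod D E) (x, x') = (vid D x, vid E x')"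
  "vcmp (dbl_prod D E) (j, j') (k, k') = (vcmp D j k, vcmp E j' k')"
  "sleft (dbl_prod D E) (\<alpha>, \<alpha>') = (sleft D \<alpha>, sleft E \<alpha>')"
  "sright (dbl_prod D E) (\<alpha>, \<alpha>') = (sright D \<alpha>, sright E \<alpha>')"
  "sqhid (dbl_prod D E) (j, j') = (sqhid D j, sqhid E j')"
  "hsq (dbl_prod D E) (\<alpha>, \<alpha>') (\<beta>, \<beta>') = (hsq D \<alpha> \<beta>, hsq E \<alpha>' \<beta>')"
  "stop (dbl_prod D E) (\<alpha>, \<alpha>') = (stop D \<alpha>, stop E \<alpha>')"
  "sbot (dbl_prod D E) (\<alpha>, \<alpha>') = (sbot D \<alpha>, sbot E \<alpha>')"
  "sqvid (dbl_prod D E) (f, f') = (sqvid D f, sqvid E f')"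
  "vsq (dbl_prod D E) (\<alpha>, \<alpha>') (\<beta>, \<beta>') = (vsq D \<alpha> \<beta>, vsq E \<alpha>' \<beta>')"
  by (simp_all add: dbl_prod_def)

lemma double_category_prod:
  assumes "double_category D" "double_category E"
  shows "double_category (dbl_prod D E)"
proof -
  interpret D: double_category D by fact
  interpret E: double_category E by fact
  have "category (ObjHor (dbl_prod D E))"
    by (intro category.intro; clarsimp simp: ObjHor_def)
  moreover have "category (ObjVer (dbl_prod D E))"
    by (intro category.intro; clarsimp simp: ObjVer_def)
  moreover have "category (VerSq (dbl_prod D E))"
    by (intro category.intro; clarsimp simp: VerSq_def)
  moreover have "category (HorSq (dbl_prod D E))"
    by (intro category.intro; clarsimp simp: HorSq_def)
  ultimately show ?thesis
    by (intro double_category.intro; clarsimp simp: D.sqhid_vcmp E.sqhid_vcmp D.sqvid_hcmp E.sqvid_hcmp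
        D.interchange E.interchange)
qed

lemma hom_psh_simps [simp]:
  "pobj (hom_psh C P Q) (x, a) = hors C (fobj P x) (fobj Q a)"
  "phor (hom_psh C P Q) (f, g) h = hcmp C (hcmp C (fhor P f) h) (fhor Q g)"
  "pver (hom_psh C P Q) (j, k) = sqs C (fver P j) (fver Q k)"
  "ptop (hom_psh C P Q) jk = stop C" "pbot (hom_psh C P Q) jk = sbot C"
  "psq (hom_psh C P Q) (\<sigma>, \<tau>) \<alpha> = hsq C (hsq C (fsq P \<sigma>) \<alpha>) (fsq Q \<tau>)"
  "pcmp (hom_psh C P Q) jk jk' = vsq C" "punit (hom_psh C P Q) xa = sqvid C"
  by (simp_all add: hom_psh_def)

text \<open>The comparison maps are natural by interchange and by \<open>sqvid_hcmp\<close>; their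
  coherence laws are the category laws of vertical composition.\<close>

lemma param_presheaf_hom_psh:
  assumes "double_functor X C P" "double_functor A C Q"
  shows "param_presheaf (dbl_prod (horop X) A) (hom_psh C P Q)"
proof -
  interpret P: double_functor X C P by fact
  interpret Q: double_functor A C Q by fact
  have "double_category (dbl_prod (horop X) A)"
    by (intro double_category_prod double_category_horop) unfold_locales
  then show ?thesis
    by (intro param_presheaf.intro param_presheaf_axioms.intro; clarsimp)
      (auto simp: hors_def sqs_def P.C.interchange P.C.sqvid_hcmp)
qed

text \<open>Componentwise inverses are automatically a transformation: each law for the inverse
  arises by applying \<theta> to the elements it produces, using the law for \<theta>, and
  cancelling.\<close>

lemma psh_isoI:
  assumes "psh_trans E K L \<theta>"
    and "\<And>x. x \<in> Obj E \<Longrightarrow> bij_betw (tobj \<theta> x) (pobj K x) (pobj L x)"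
    and "\<And>j. j \<in> Ver E \<Longrightarrow> bij_betw (tver \<theta> j) (pver K j) (pver L j)"
  shows "psh_iso E K L \<theta>"
proof -
  interpret psh_trans E K L \<theta> by fact
  define \<kappa> where "\<kappa> = \<lparr>tobj = (\<lambda>x\<in>Obj E. \<lambda>b\<in>pobj L x. the_inv_into (pobj K x) (tobj \<theta> x) b),
    tver = (\<lambda>j\<in>Ver E. \<lambda>w\<in>pver L j. the_inv_into (pver K j) (tver \<theta> j) w)\<rparr>"
  have \<theta>o [simp]: "tobj \<theta> x a \<in> pobj L x" if "x \<in> Obj E" "a \<in> pobj K x" for x a
    using bij_betwE[OF assms(2)] that by blast
  have \<theta>v [simp]: "tver \<theta> j u \<in> pver L j" if "j \<in> Ver E" "u \<in> pver K j" for j u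
    using bij_betwE[OF assms(3)] that by blast
  have \<kappa>o [simp]: "tobj \<kappa> x b \<in> pobj K x" "tobj \<theta> x (tobj \<kappa> x b) = b"
    if "x \<in> Obj E" "b \<in> pobj L x" for x b
    using that bij_betw_the_inv_into[OF assms(2)] f_the_inv_into_f_bij_betw[OF assms(2)]
    by (auto simp: \<kappa>_def dest: bij_betwE)
  have \<kappa>v [simp]: "tver \<kappa> j w \<in> pver K j" "tver \<theta> j (tver \<kappa> j w) = w"
    if "j \<in> Ver E" "w \<in> pver L j" for j w
    using that bij_betw_the_inv_into[OF assms(3)] f_the_inv_into_f_bij_betw[OF assms(3)]
    by (auto simp: \<kappa>_def dest: bij_betwE)
  have \<kappa>\<theta>o [simp]: "tobj \<kappa> x (tobj \<theta> x a) = a" if "x \<in> Obj E" "a \<in> pobj K x" for x a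
    using that the_inv_into_f_f[OF bij_betw_imp_inj_on[OF assms(2)]] by (simp add: \<kappa>_def)
  have \<kappa>\<theta>v [simp]: "tver \<kappa> j (tver \<theta> j u) = u" if "j \<in> Ver E" "u \<in> pver K j" for j u
    using that the_inv_into_f_f[OF bij_betw_imp_inj_on[OF assms(3)]] by (simp add: \<kappa>_def)
  have Kp [simp]: "ptop K j u \<in> pobj K (vdom E j)" "pbot K j u \<in> pobj K (vcod E j)"
    if "j \<in> Ver E" "u \<in> pver K j" for j u
    using K.ptop_in K.pbot_in that by blast+
  \<comment> \<open>The legs come first: they guarantee that inverse images of elements with
    matching legs match again, so that the comparison maps may be applied to them.\<close>
  have top: "ptop K j (tver \<kappa> j w) = tobj \<kappa> (vdom E j) (ptop L j w)"
    and bot: "pbot K j (tver \<kappa> j w) = tobj \<kappa> (vcod E j) (pbot L j w)"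
    if "j \<in> Ver E" "w \<in> pver L j" for j w
    using that tver_top[of j "tver \<kappa> j w"] tver_bot[of j "tver \<kappa> j w"] by simp_all
  have "psh_trans E L K \<kappa>"
  proof (intro psh_trans.intro psh_trans_axioms.intro)
    show "param_presheaf E L" "param_presheaf E K" by unfold_locales
    show "tobj \<kappa> \<in> (\<Pi>\<^sub>E x\<in>Obj E. pobj L x \<rightarrow>\<^sub>E pobj K x)"
      "tver \<kappa> \<in> (\<Pi>\<^sub>E j\<in>Ver E. pver L j \<rightarrow>\<^sub>E pver K j)"
      by (auto simp del: \<kappa>o \<kappa>v intro!: PiE_I simp: \<kappa>o(1) \<kappa>v(1)) (auto simp: \<kappa>_def)
    show "phor K f (tobj \<kappa> (hdom E f) b) = tobj \<kappa> (hcod E f) (phor L f b)"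
      if "f \<in> Hor E" "b \<in> pobj L (hdom E f)" for f b
    proof -
      have "phor K f (tobj \<kappa> (hdom E f) b) \<in> pobj K (hcod E f)"
        using that K.phor_in by (intro funcset_mem[OF K.phor_in]) auto
      then have "phor K f (tobj \<kappa> (hdom E f) b)
          = tobj \<kappa> (hcod E f) (tobj \<theta> (hcod E f) (phor K f (tobj \<kappa> (hdom E f) b)))"
        using that by simp
      also have "\<dots> = tobj \<kappa> (hcod E f) (phor L f b)"
        using that natural_hor[of f "tobj \<kappa> (hdom E f) b"] by simp
      finally show ?thesis .
    qed
    show "psq K \<alpha> (tver \<kappa> (sleft E \<alpha>) w) = tver \<kappa> (sright E \<alpha>) (psq L \<alpha> w)"
      if "\<alpha> \<in> Sq E" "w \<in> pver L (sleft E \<alpha>)" for \<alpha> w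
    proof -
      have "psq K \<alpha> (tver \<kappa> (sleft E \<alpha>) w) \<in> pver K (sright E \<alpha>)"
        using that by (intro funcset_mem[OF K.psq_in]) auto
      then have "psq K \<alpha> (tver \<kappa> (sleft E \<alpha>) w)
          = tver \<kappa> (sright E \<alpha>) (tver \<theta> (sright E \<alpha>) (psq K \<alpha> (tver \<kappa> (sleft E \<alpha>) w)))"
        using that by simp
      also have "\<dots> = tver \<kappa> (sright E \<alpha>) (psq L \<alpha> w)"
        using that natural_sq[of \<alpha> "tver \<kappa> (sleft E \<alpha>) w"] by simp
      finally show ?thesis .
    qed
    show "tver \<kappa> (vcmp E j k) (pcmp L j k u w) = pcmp K j k (tver \<kappa> j u) (tver \<kappa> k w)"
      if "j \<in> Ver E" "k \<in> Ver E" "vcod E j = vdom E k" "u \<in> pver L j" "w \<in> pver L k"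
        "pbot L j u = ptop L k w" for j k u w
    proof -
      have *: "pbot K j (tver \<kappa> j u) = ptop K k (tver \<kappa> k w)" using that by (simp add: top bot)
      then have "pcmp K j k (tver \<kappa> j u) (tver \<kappa> k w) \<in> pver K (vcmp E j k)"
        using that K.pcmp_span[of j k "tver \<kappa> j u" "tver \<kappa> k w"] by simp
      then have "pcmp K j k (tver \<kappa> j u) (tver \<kappa> k w)
          = tver \<kappa> (vcmp E j k) (tver \<theta> (vcmp E j k) (pcmp K j k (tver \<kappa> j u) (tver \<kappa> k w)))"
        using that by simp
      also have "\<dots> = tver \<kappa> (vcmp E j k) (pcmp L j k u w)"
        using that comm_pcmp[of j k "tver \<kappa> j u" "tver \<kappa> k w"] * by simp
      finally show ?thesis by simp
    qed
    show "tver \<kappa> (vid E x) (punit L x b) = punit K x (tobj \<kappa> x b)"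
      if "x \<in> Obj E" "b \<in> pobj L x" for x b
    proof -
      have "punit K x (tobj \<kappa> x b) \<in> pver K (vid E x)"
        using that K.punit_span[of x "tobj \<kappa> x b"] by simp
      then have "punit K x (tobj \<kappa> x b) = tver \<kappa> (vid E x) (tver \<theta> (vid E x) (punit K x (tobj \<kappa> x b)))"
        using that by simp
      also have "\<dots> = tver \<kappa> (vid E x) (punit L x b)"
        using that comm_punit[of x "tobj \<kappa> x b"] by simp
      finally show ?thesis by simp
    qed
  qed (use top bot in auto)
  then show ?thesis using assms(1) by (auto simp: psh_iso_def)
qed

lemma psh_iso_bij_betw:
  assumes "psh_iso E K L \<theta>" "j \<in> Ver E"
  shows "bij_betw (tver \<theta> j) (pver K j) (pver L j)"
proof -
  from assms obtain \<kappa> where "psh_trans E K L \<theta>" "psh_trans E L K \<kappa>"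
    and inv: "\<forall>u\<in>pver K j. tver \<kappa> j (tver \<theta> j u) = u" "\<forall>w\<in>pver L j. tver \<theta> j (tver \<kappa> j w) = w"
    unfolding psh_iso_def by blast
  then have "tver \<theta> j \<in> pver K j \<rightarrow> pver L j" "tver \<kappa> j \<in> pver L j \<rightarrow> pver K j"
    using psh_trans.tver_in assms(2) by (fastforce simp: PiE_def Pi_def)+
  with inv show ?thesis by (intro bij_betw_byWitness[where f' = "tver \<kappa> j"]) auto
qed

section \<open>Transposition as a presheaf isomorphism\<close>

context hor_double_adjunction
begin

abbreviation (input) "\<theta> \<equiv> \<lparr>tobj = transpose_hor X A F G \<eta>, tver = transpose_sq X A F G \<eta>\<rparr>"

text \<open>Naturality in the contravariant variable is naturality of the unit, in the covariant one
  functoriality of \<open>G\<close>. The comparison maps are respected by interchange and since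
  \<eta> preserves vertical composites and identities.\<close>

lemma transpose_presheaf_iso_data: "(F, G, \<theta>) \<in> presheaf_iso_data X A"
proof -
  let ?E = "dbl_prod (horop X) A" and ?K = "hom_psh A F (dfun_id A)" and ?L = "hom_psh X (dfun_id X) G"
  have K: "param_presheaf ?E ?K" and L: "param_presheaf ?E ?L"
    by (intro param_presheaf_hom_psh double_functor_id F.double_functor_axioms G.double_functor_axioms
        unit.F.D.double_category_axioms counit.F.D.double_category_axioms)+
  have hor: "transpose_hor X A F G \<eta> (x, a) f = hcmp X (on_ob \<eta> x) (fhor G f)"
    if "x \<in> Obj X" "f \<in> Hor A" "hdom A f = fobj F x" "hcod A f = a" for x a f
    using that by (auto simp: transpose_hor_def hors_def)
  have sq: "transpose_sq X A F G \<eta> (j, k) \<alpha> = hsq X (on_ar \<eta> j) (fsq G \<alpha>)"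
    if "j \<in> Ver X" "\<alpha> \<in> Sq A" "sleft A \<alpha> = fver F j" "sright A \<alpha> = k" for j k \<alpha>
    using that by (auto simp: transpose_sq_def sqs_def)
  have "psh_trans ?E ?K ?L \<theta>"
  proof (intro psh_trans.intro psh_trans_axioms.intro K L)
    show "tobj \<theta> \<in> (\<Pi>\<^sub>E x\<in>Obj ?E. pobj ?K x \<rightarrow>\<^sub>E pobj ?L x)"
      by (auto simp: transpose_hor_def hors_def split: if_splits)
    show "tver \<theta> \<in> (\<Pi>\<^sub>E j\<in>Ver ?E. pver ?K j \<rightarrow>\<^sub>E pver ?L j)"
      by (auto simp: transpose_sq_def sqs_def split: if_splits)
    show "phor ?L f (tobj \<theta> (hdom ?E f) a) = tobj \<theta> (hcod ?E f) (phor ?K f a)"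
      if fa: "f \<in> Hor ?E" "a \<in> pobj ?K (hdom ?E f)" for f a
    proof -
      obtain g h where f: "f = (g, h)" and m: "g \<in> Hor X" "h \<in> Hor A" "a \<in> Hor A"
        "hdom A a = fobj F (hcod X g)" "hcod A a = hdom A h"
        using fa by (cases f) (auto simp: hors_def)
      have "hcmp X (hcmp X (on_ob \<eta> (hdom X g)) (fhor G (fhor F g))) (hcmp X (fhor G a) (fhor G h))
          = hcmp X (hcmp X g (on_ob \<eta> (hcod X g))) (hcmp X (fhor G a) (fhor G h))"
        using unit_natural_hor[of g] m by simp
      then show ?thesis using m by (simp add: f hor)
    qed
    show "psq ?L \<alpha> (tver \<theta> (sleft ?E \<alpha>) u) = tver \<theta> (sright ?E \<alpha>) (psq ?K \<alpha> u)"
      if \<alpha>u: "\<alpha> \<in> Sq ?E" "u \<in> pver ?K (sleft ?E \<alpha>)" for \<alpha> u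
    proof -
      obtain \<sigma> \<tau> where f: "\<alpha> = (\<sigma>, \<tau>)" and m: "\<sigma> \<in> Sq X" "\<tau> \<in> Sq A" "u \<in> Sq A"
        "sleft A u = fver F (sright X \<sigma>)" "sright A u = sleft A \<tau>"
        using \<alpha>u by (cases \<alpha>) (auto simp: sqs_def)
      have "hsq X (hsq X (on_ar \<eta> (sleft X \<sigma>)) (fsq G (fsq F \<sigma>))) (hsq X (fsq G u) (fsq G \<tau>))
          = hsq X (hsq X \<sigma> (on_ar \<eta> (sright X \<sigma>))) (hsq X (fsq G u) (fsq G \<tau>))"
        using unit_natural[of \<sigma>] m by simp
      then show ?thesis using m by (simp add: f sq)
    qed
  qed (auto simp: hors_def sqs_def hor sq unit.F.D.interchange unit.F.D.sqvid_hcmp)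
  moreover have "bij_betw (tobj \<theta> x) (pobj ?K x) (pobj ?L x)" if "x \<in> Obj ?E" for x
    using that bij_betw_flat_hor by (auto simp: transpose_hor_def)
  moreover have "bij_betw (tver \<theta> j) (pver ?K j) (pver ?L j)" if "j \<in> Ver ?E" for j
    using that bij_betw_flat by (auto simp: transpose_sq_def)
  ultimately have "psh_iso ?E ?K ?L \<theta>" by (rule psh_isoI)
  then show ?thesis
    by (simp add: presheaf_iso_data_def F.double_functor_axioms G.double_functor_axioms)
qed

end

section \<open>Presheaf isomorphisms as natural families of bijections\<close>

lemma presheaf_iso_data_hom_bijection_data:
  assumes "(F, G, \<theta>) \<in> presheaf_iso_data X A"
  shows "(F, G, tver \<theta>) \<in> hom_bijection_data X A"
proof -
  let ?E = "dbl_prod (horop X) A" and ?K = "hom_psh A F (dfun_id A)" and ?L = "hom_psh X (dfun_id X) G"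
  interpret F: double_functor X A F using assms by (simp add: presheaf_iso_data_def)
  interpret G: double_functor A X G using assms by (simp add: presheaf_iso_data_def)
  have iso: "psh_iso ?E ?K ?L \<theta>" using assms by (simp add: presheaf_iso_data_def)
  then interpret psh_trans ?E ?K ?L \<theta> by (simp add: psh_iso_def)
  have bij: "bij_betw (tver \<theta> (j, k)) (sqs A (fver F j) k) (sqs X j (fver G k))"
    if "j \<in> Ver X" "k \<in> Ver A" for j k
    using psh_iso_bij_betw[OF iso, of "(j, k)"] that by simp
  have mem: "tver \<theta> (j, k) \<alpha> \<in> Sq X" "sleft X (tver \<theta> (j, k) \<alpha>) = j" "sright X (tver \<theta> (j, k) \<alpha>) = fver G k"
    if "j \<in> Ver X" "k \<in> Ver A" "\<alpha> \<in> sqs A (fver F j) k" for j k \<alpha>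
    using bij_betwE[OF bij[of j k]] that by (auto simp: sqs_def)
  have "hom_bijection X A F G (tver \<theta>)"
  proof (intro hom_bijection.intro hom_bijection_axioms.intro F.double_functor_axioms
      G.double_functor_axioms bij)
    \<comment> \<open>Joint naturality is split into the two variables by putting a horizontal
      identity square in the other place.\<close>
    show "tver \<theta> (j', k) (hsq A (fsq F \<sigma>) \<alpha>) = hsq X \<sigma> (tver \<theta> (j, k) \<alpha>)"
      if "j' \<in> Ver X" "j \<in> Ver X" "k \<in> Ver A" "\<sigma> \<in> sqs X j' j" "\<alpha> \<in> sqs A (fver F j) k" for j' j k \<sigma> \<alpha>
      using natural_sq[of "(\<sigma>, sqhid A k)" \<alpha>] that mem[of j k \<alpha>] by (simp add: sqs_def)
    show "tver \<theta> (j, k') (hsq A \<alpha> \<tau>) = hsq X (tver \<theta> (j, k) \<alpha>) (fsq G \<tau>)"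
      if "j \<in> Ver X" "k \<in> Ver A" "k' \<in> Ver A" "\<alpha> \<in> sqs A (fver F j) k" "\<tau> \<in> sqs A k k'" for j k k' \<alpha> \<tau>
      using natural_sq[of "(sqhid X j, \<tau>)" \<alpha>] that mem[of j k \<alpha>] by (simp add: sqs_def)
    fix j j' k k' \<alpha> \<beta>
    assume m: "j \<in> Ver X" "j' \<in> Ver X" "k \<in> Ver A" "k' \<in> Ver A" "\<alpha> \<in> sqs A (fver F j) k"
      "\<beta> \<in> sqs A (fver F j') k'" "vcod X j = vdom X j'" "vcod A k = vdom A k'" "sbot A \<alpha> = stop A \<beta>"
    show "sbot X (tver \<theta> (j, k) \<alpha>) = stop X (tver \<theta> (j', k') \<beta>)"
      using tver_bot[of "(j, k)" \<alpha>] tver_top[of "(j', k')" \<beta>] m by simp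
    show "tver \<theta> (vcmp X j j', vcmp A k k') (vsq A \<alpha> \<beta>) = vsq X (tver \<theta> (j, k) \<alpha>) (tver \<theta> (j', k') \<beta>)"
      using comm_pcmp[of "(j, k)" "(j', k')" \<alpha> \<beta>] m by simp
  qed
  moreover have "tver \<theta> \<in> (\<Pi>\<^sub>E (j, k)\<in>Ver X \<times> Ver A. sqs A (fver F j) k \<rightarrow>\<^sub>E sqs X j (fver G k))"
  proof -
    have "(\<Pi>\<^sub>E jk\<in>Ver ?E. pver ?K jk \<rightarrow>\<^sub>E pver ?L jk)
        = (\<Pi>\<^sub>E (j, k)\<in>Ver X \<times> Ver A. sqs A (fver F j) k \<rightarrow>\<^sub>E sqs X j (fver G k))"
      by (unfold dbl_prod_simps horop_simps, intro PiE_cong) auto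
    then show ?thesis using tver_in by simp
  qed
  ultimately show ?thesis by (simp add: hom_bijection_data_iff)
qed

text \<open>Compatibility with the unit comparison maps says that the identity square of
  \<open>tobj \<theta> (x, a) f\<close> is the value of \<open>tver \<theta>\<close> at the identity
  square of \<open>f\<close>. Taking tops recovers \<open>tobj\<close> from
  \<open>tver\<close>.\<close>

lemma transpose_hor_hom_unit:
  assumes "(F, G, \<theta>) \<in> presheaf_iso_data X A"
  shows "transpose_hor X A F G (hom_unit X A F (tver \<theta>)) = tobj \<theta>"
proof -
  let ?E = "dbl_prod (horop X) A" and ?K = "hom_psh A F (dfun_id A)" and ?L = "hom_psh X (dfun_id X) G"
  interpret psh_trans ?E ?K ?L \<theta> using assms by (simp add: presheaf_iso_data_def psh_iso_def)
  interpret U: hom_bijection X A F G "tver \<theta>"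
    using presheaf_iso_data_hom_bijection_data[OF assms] by (simp add: hom_bijection_data_iff)
  have tobj: "tobj \<theta> (x, a) \<in> hors A (fobj F x) a \<rightarrow>\<^sub>E hors X x (fobj G a)"
    if "x \<in> Obj X" "a \<in> Obj A" for x a
    using PiE_mem[OF tobj_in, of "(x, a)"] that by simp
  have eq: "hcmp X (on_ob (hom_unit X A F (tver \<theta>)) x) (fhor G f) = tobj \<theta> (x, a) f"
    if x: "x \<in> Obj X" and a: "a \<in> Obj A" and f: "f \<in> hors A (fobj F x) a" for x a f
  proof -
    have f': "f \<in> Hor A" "hdom A f = fobj F x" "hcod A f = a" using f by (auto simp: hors_def)
    have t: "tobj \<theta> (x, a) f \<in> Hor X" using tobj[OF x a] f by (auto simp: hors_def)
    have "sqvid X (tobj \<theta> (x, a) f) = tver \<theta> (vid X x, vid A a) (sqvid A f)"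
      using comm_punit[of "(x, a)" f] x a f by simp
    also have "\<dots> = hsq X (U.unit_sq (vid X x)) (fsq G (sqvid A f))"
      using x a f' by (intro U.phi_eq) (simp_all add: sqs_def)
    finally have "stop X (sqvid X (tobj \<theta> (x, a) f)) = stop X (hsq X (U.unit_sq (vid X x)) (fsq G (sqvid A f)))"
      by simp
    also have "\<dots> = hcmp X (U.unit_hor x) (fhor G f)"
      using x f' by (subst U.F.D.top_hsq) auto
    finally show ?thesis using t x by (simp add: hom_unit_def U.unit_hor_def U.unit_sq_def)
  qed
  show ?thesis
  proof (rule extensionalityI)
    show "tobj \<theta> \<in> extensional (Obj X \<times> Obj A)" using tobj_in by (auto simp: PiE_def)
    show "transpose_hor X A F G (hom_unit X A F (tver \<theta>)) \<in> extensional (Obj X \<times> Obj A)"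
      by (simp add: transpose_hor_def)
    fix xa assume "xa \<in> Obj X \<times> Obj A"
    then obtain x a where xa: "xa = (x, a)" "x \<in> Obj X" "a \<in> Obj A" by auto
    have "tobj \<theta> (x, a) \<in> extensional (hors A (fobj F x) a)" using tobj[of x a] xa by (simp add: PiE_def)
    then have "(\<lambda>f\<in>hors A (fobj F x) a. hcmp X (on_ob (hom_unit X A F (tver \<theta>)) x) (fhor G f)) = tobj \<theta> (x, a)"
      by (rule extensionalityI[OF restrict_extensional]) (simp add: eq xa)
    then show "transpose_hor X A F G (hom_unit X A F (tver \<theta>)) xa = tobj \<theta> xa"
      using xa by (simp add: transpose_hor_def)
  qed
qed

lemma bij_betw_presheaf_iso_data:
  fixes X :: "('o, 'h, 'v, 's) dbl" and A :: "('p, 'k, 'w, 't) dbl"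
  shows "bij_betw
    (\<lambda>(F, G, \<eta>, \<epsilon>). (F, G, \<lparr>tobj = transpose_hor X A F G \<eta>, tver = transpose_sq X A F G \<eta>\<rparr>))
    (adjunctions X A) (presheaf_iso_data X A)"
proof (rule bij_betw_byWitness[where f' = "\<lambda>(F, G, \<theta>). (F, G, hom_unit X A F (tver \<theta>),
      universal_unit.counit X A G (vertical_part F) (hom_unit X A F (tver \<theta>)))"], goal_cases)
  case 1
  then show ?case
    by (auto simp: adjunctions_def hor_double_adjunction.hom_unit_transpose_sq
        hor_double_adjunction.counit_eq)
next
  case 2
  then show ?case
    by (auto simp: transpose_hor_hom_unit transpose_sq_hom_unit presheaf_iso_data_hom_bijection_data)
next
  case 3
  then show ?case
    by (auto simp: adjunctions_def hor_double_adjunction.transpose_presheaf_iso_data)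
next
  case 4
  then show ?case
    by (auto simp: adjunctions_def intro!: hom_bijection_adjunction
        dest: presheaf_iso_data_hom_bijection_data simp: hom_bijection_data_iff)
qed

theorem theorem5p2:
  fixes X :: "('o, 'h, 'v, 's) dbl" and A :: "('p, 'k, 'w, 't) dbl"
  assumes "double_category X" and "double_category A"
  shows
    "bij_betw (\<lambda>(F, G, \<eta>, \<epsilon>). (F, G, \<eta>)) (adjunctions X A) (unit_data X A) \<and>

     bij_betw (\<lambda>(F, G, \<eta>, \<epsilon>). (G, vertical_part F, \<eta>)) (adjunctions X A) (universal_unit_data X A) \<and>
     (\<forall>(G, F\<^sub>0, \<eta>) \<in> universal_unit_data X A. \<exists>F \<epsilon>.
        hor_double_adjunction X A F G \<eta> \<epsilon> \<and> vertical_part F = F\<^sub>0 \<and>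
        (\<forall>\<chi>\<in>Sq X.
           {\<beta> \<in> sqs A (on_ar F\<^sub>0 (sleft X \<chi>)) (on_ar F\<^sub>0 (sright X \<chi>)).
              hsq X (on_ar \<eta> (sleft X \<chi>)) (fsq G \<beta>) = hsq X \<chi> (on_ar \<eta> (sright X \<chi>))} = {fsq F \<chi>})) \<and>

     bij_betw (\<lambda>(F, G, \<eta>, \<epsilon>). (F, G, \<epsilon>)) (adjunctions X A) (counit_data X A) \<and>

     bij_betw (\<lambda>(F, G, \<eta>, \<epsilon>). (F, vertical_part G, \<epsilon>)) (adjunctions X A) (universal_counit_data X A) \<and>
     (\<forall>(F, G\<^sub>0, \<epsilon>) \<in> universal_counit_data X A. \<exists>G \<eta>.
        hor_double_adjunction X A F G \<eta> \<epsilon> \<and> vertical_part G = G\<^sub>0 \<and>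
        (\<forall>\<alpha>\<in>Sq A.
           {\<beta> \<in> sqs X (on_ar G\<^sub>0 (sleft A \<alpha>)) (on_ar G\<^sub>0 (sright A \<alpha>)).
              hsq A (fsq F \<beta>) (on_ar \<epsilon> (sright A \<alpha>)) = hsq A (on_ar \<epsilon> (sleft A \<alpha>)) \<alpha>} = {fsq G \<alpha>})) \<and>

     bij_betw (\<lambda>(F, G, \<eta>, \<epsilon>). (F, G, transpose_sq X A F G \<eta>)) (adjunctions X A) (hom_bijection_data X A) \<and>

     bij_betw (\<lambda>(F, G, \<eta>, \<epsilon>). (F, G, \<lparr>tobj = transpose_hor X A F G \<eta>, tver = transpose_sq X A F G \<eta>\<rparr>))
       (adjunctions X A) (presheaf_iso_data X A)"
  using assms universal_unit_data_squares[OF assms] universal_counit_data_squares[OF assms]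
  by (intro conjI bij_betw_unit_data bij_betw_universal_unit_data bij_betw_counit_data
      bij_betw_universal_counit_data bij_betw_hom_bijection_data bij_betw_presheaf_iso_data) auto

end
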